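(* Let $S\subseteq\mathbb{R}^+$ be a finite simple metric spectrum. Suppose the block decomposition $S=\bigcup_{i=1}^k B_i$ satisfies $|B_1|=k-1$ and $|B_i|=1$ for $i>1$. Then the countable Urysohn space $\mathbb{U}_S$ admits finite big Ramsey degrees (that is, every finite subspace of $\mathbb{U}_S$ has finite big Ramsey degree in $\mathbb{U}_S$).
   Context: A spectrum is a finite set $S\subseteq\mathbb{R}^+$ of positive reals. $\mathcal{M}_S$ is the class of finite metric spaces with distances in $\{0\}\cup S$, with isometric embeddings. The block decomposition of $S$ is the partition $S=\bigcup_{i=1}^k B_i$ defined recursively by $B_1=\{a\in S: a\le 2\min S\}$ and $B_{i+1}=\{a\in S\setminus\bigcup_{j=1}^i B_j: a\le 2\min(S\setminus\bigcup_{j=1}^i B_j)\}$, until $S$ is exhausted. Two distinct blocks $B_i,B_j$ with $i<j$ are independent if $2\max B_i<\min B_j$; $S$ is simple if every pair of distinct blocks is independent. For simple $S$, $\mathcal{M}_S$ is a Fraïssé class (viewing a metric space as a structure with binary relations $R_s$, $s\in S$, where $xR_sy\iff d(x,y)=s$), and $\mathbb{U}_S$ denotes its Fraïssé limit: the countable ultrahomogeneous metric space with distances in $\{0\}\cup S$ whose finite subspaces are, up to isometry, exactly the members of $\mathcal{M}_S$. For a finite $\mathbf{A}\in\mathcal{M}_S$, let $\binom{X}{\mathbf{A}}$ be the set of subspaces of $X$ isometric to $\mathbf{A}$; $\mathbf{A}$ has finite big Ramsey degree in $\mathbb{U}_S$ if there is $t\in\omega$ such that for every $k\in\omega$ and $c:\binom{\mathbb{U}_S}{\mathbf{A}}\to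 k$ there is a subspace $X\subseteq\mathbb{U}_S$ isometric to $\mathbb{U}_S$ with $|c[\binom{X}{\mathbf{A}}]|\le t$. *)

theory Defs
  imports "HOL-Analysis.Analysis"
begin

section \<open>Spectra and their block decomposition\<close>

definition spectrum :: "real set \<Rightarrow> bool" where
  "spectrum S \<longleftrightarrow> finite S \<and> S \<subseteq> {0<..}"

definition first_block :: "real set \<Rightarrow> real set" where
  "first_block R = {a \<in> R. a \<le> 2 * Min R}"

text \<open>Blocks are indexed from 1; \<open>block S 0\<close> is meaningless. Past the exhaustion of \<open>S\<close> the
  recursion yields empty sets, which do not count as blocks: the blocks of \<open>S\<close> are exactly
  \<open>block S 1, \<dots>, block S (num_blocks S)\<close>.\<close>

fun block :: "real set \<Rightarrow> nat \<Rightarrow> real set" where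
  "block S i = first_block (S - (\<Union>j\<in>{1..<i}. block S j))"

declare block.simps [simp del]

definition num_blocks :: "real set \<Rightarrow> nat" where
  "num_blocks S = (LEAST k. S = (\<Union>i\<in>{1..k}. block S i))"

definition independent_blocks :: "real set \<Rightarrow> real set \<Rightarrow> bool" where
  "independent_blocks B C \<longleftrightarrow> 2 * Max B < Min C"

definition simple_spectrum :: "real set \<Rightarrow> bool" where
  "simple_spectrum S \<longleftrightarrow> spectrum S \<and>
     (\<forall>i j. 1 \<le> i \<and> i < j \<and> j \<le> num_blocks S \<longrightarrow> independent_blocks (block S i) (block S j))"

lemma first_block_subset: "first_block R \<subseteq> R"
  by (auto simp: first_block_def)

lemma first_block_eq_empty_iff:
  assumes "spectrum R"
  shows "first_block R = {} \<longleftrightarrow> R = {}"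
proof
  assume e: "first_block R = {}"
  show "R = {}"
  proof (rule ccontr)
    assume ne: "R \<noteq> {}"
    have "finite R" using assms by (simp add: spectrum_def)
    then have m: "Min R \<in> R" using ne by simp
    then have "0 < Min R" using assms by (auto simp: spectrum_def)
    then have "Min R \<in> first_block R" using m by (simp add: first_block_def)
    then show False using e by simp
  qed
qed (simp add: first_block_def)

lemma block_subset: "block S i \<subseteq> S"
  by (subst block.simps) (use first_block_subset in blast)

lemma block_disjoint:
  assumes "1 \<le> i" "i < j"
  shows "block S i \<inter> block S j = {}"
  using assms first_block_subset[of "S - (\<Union>l\<in>{1..<j}. block S l)"]
  by (subst (2) block.simps) fastforce

lemma blocks_exhaust:
  assumes "spectrum S"
  shows "\<exists>k. S = (\<Union>i\<in>{1..k}. block S i)"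
proof -
  have fin: "finite S" using assms by (simp add: spectrum_def)
  have sub: "(\<Union>i\<in>{1..k}. block S i) \<subseteq> S" for k
    using block_subset by blast
  have "S = (\<Union>i\<in>{1..k}. block S i) \<or> k \<le> card (\<Union>i\<in>{1..k}. block S i)" for k
  proof (induction k)
    case (Suc k)
    let ?U = "\<Union>i\<in>{1..k}. block S i"
    have U': "(\<Union>i\<in>{1..Suc k}. block S i) = ?U \<union> block S (Suc k)"
      by (auto simp: atLeastAtMostSuc_conv)
    have b: "block S (Suc k) = first_block (S - ?U)"
      by (subst block.simps) (simp add: atLeastLessThanSuc_atLeastAtMost)
    show ?case
    proof (cases "S = ?U")
      case True
      then show ?thesis using U' sub[of "Suc k"] by auto
    next
      case False
      then have ne: "S - ?U \<noteq> {}" using sub[of k] by blast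
      have "spectrum (S - ?U)" using assms by (auto simp: spectrum_def)
      then have "first_block (S - ?U) \<noteq> {}" using ne by (simp add: first_block_eq_empty_iff)
      then obtain a where a: "a \<in> block S (Suc k)" "a \<notin> ?U"
        using b first_block_subset[of "S - ?U"] by auto
      then have "card ?U < card (\<Union>i\<in>{1..Suc k}. block S i)"
        using U' sub[of "Suc k"] fin by (intro psubset_card_mono) (auto intro: finite_subset)
      then show ?thesis using Suc False by linarith
    qed
  qed simp
  from this[of "Suc (card S)"] show ?thesis
    using card_mono[OF fin sub[of "Suc (card S)"]] by (metis not_less_eq_eq)
qed

lemma Union_blocks:
  assumes "spectrum S"
  shows "(\<Union>i\<in>{1..num_blocks S}. block S i) = S"
  using LeastI_ex[OF blocks_exhaust[OF assms]] unfolding num_blocks_def by simp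

lemma block_nonempty:
  assumes "spectrum S" "1 \<le> i" "i \<le> num_blocks S"
  shows "block S i \<noteq> {}"
proof
  assume e: "block S i = {}"
  have "spectrum (S - (\<Union>j\<in>{1..<i}. block S j))"
    using assms(1) by (auto simp: spectrum_def)
  then have "S - (\<Union>j\<in>{1..<i}. block S j) = {}"
    using e block.simps[of S i] first_block_eq_empty_iff by simp
  then have "S = (\<Union>j\<in>{1..<i}. block S j)"
    using block_subset by blast
  moreover have "{1..<i} = {1..i - 1}" using assms(2) by auto
  ultimately have "S = (\<Union>j\<in>{1..i - 1}. block S j)" by simp
  then have "num_blocks S \<le> i - 1"
    unfolding num_blocks_def by (rule Least_le)
  then show False using assms by simp
qed

section \<open>Metric spaces with distances in a spectrum\<close>

text \<open>A metric space is a carrier set together with a distance function, as in the locale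
  \<^locale>\<open>Metric_space\<close>; a subspace is a subset of the carrier with the same distance function.\<close>

definition metric_space_over :: "real set \<Rightarrow> 'a set \<Rightarrow> ('a \<Rightarrow> 'a \<Rightarrow> real) \<Rightarrow> bool" where
  "metric_space_over S M d \<longleftrightarrow> Metric_space M d \<and> (\<forall>x\<in>M. \<forall>y\<in>M. d x y \<in> {0} \<union> S)"

definition isometry ::
    "'a set \<Rightarrow> ('a \<Rightarrow> 'a \<Rightarrow> real) \<Rightarrow> 'b set \<Rightarrow> ('b \<Rightarrow> 'b \<Rightarrow> real) \<Rightarrow> ('a \<Rightarrow> 'b) \<Rightarrow> bool" where
  "isometry M d N e f \<longleftrightarrow> bij_betw f M N \<and> (\<forall>x\<in>M. \<forall>y\<in>M. e (f x) (f y) = d x y)"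

definition isometric ::
    "'a set \<Rightarrow> ('a \<Rightarrow> 'a \<Rightarrow> real) \<Rightarrow> 'b set \<Rightarrow> ('b \<Rightarrow> 'b \<Rightarrow> real) \<Rightarrow> bool" where
  "isometric M d N e \<longleftrightarrow> (\<exists>f. isometry M d N e f)"

definition ultrahomogeneous :: "'a set \<Rightarrow> ('a \<Rightarrow> 'a \<Rightarrow> real) \<Rightarrow> bool" where
  "ultrahomogeneous U d \<longleftrightarrow>
     (\<forall>F G f. finite F \<and> F \<subseteq> U \<and> G \<subseteq> U \<and> isometry F d G d f \<longrightarrow>
        (\<exists>g. isometry U d U d g \<and> (\<forall>x\<in>F. g x = f x)))"

text \<open>Being the countable Urysohn space determines \<open>(U, d)\<close> up to isometry only. Its finite
  subspaces belong to \<open>M\<^sub>S\<close> because its distances lie in \<open>{0} \<union> S\<close>. Conversely every member of \<open>M\<^sub>S\<close>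
  is isometric to a subspace; it is enough to ask this for carriers consisting of natural
  numbers, since every finite metric space has an isometric copy of this form.\<close>

definition countable_Urysohn :: "real set \<Rightarrow> 'a set \<Rightarrow> ('a \<Rightarrow> 'a \<Rightarrow> real) \<Rightarrow> bool" where
  "countable_Urysohn S U d \<longleftrightarrow>
     countable U \<and> metric_space_over S U d \<and> ultrahomogeneous U d \<and>
     (\<forall>(A::nat set) e. finite A \<and> metric_space_over S A e \<longrightarrow> (\<exists>F\<subseteq>U. isometric A e F d))"

section \<open>Big Ramsey degrees\<close>

definition copies ::
    "'a set \<Rightarrow> ('a \<Rightarrow> 'a \<Rightarrow> real) \<Rightarrow> 'b set \<Rightarrow> ('b \<Rightarrow> 'b \<Rightarrow> real) \<Rightarrow> 'a set set" where
  "copies X d A e = {Y. Y \<subseteq> X \<and> isometric A e Y d}"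

definition finite_big_Ramsey_degree ::
    "'b set \<Rightarrow> ('b \<Rightarrow> 'b \<Rightarrow> real) \<Rightarrow> 'a set \<Rightarrow> ('a \<Rightarrow> 'a \<Rightarrow> real) \<Rightarrow> bool" where
  "finite_big_Ramsey_degree A e U d \<longleftrightarrow>
     (\<exists>t::nat. \<forall>(k::nat) c. c \<in> copies U d A e \<rightarrow> {..<k} \<longrightarrow>
        (\<exists>X\<subseteq>U. isometric U d X d \<and> card (c ` copies X d A e) \<le> t))"

definition admits_finite_big_Ramsey_degrees :: "'a set \<Rightarrow> ('a \<Rightarrow> 'a \<Rightarrow> real) \<Rightarrow> bool" where
  "admits_finite_big_Ramsey_degrees U d \<longleftrightarrow>
     (\<forall>A\<subseteq>U. finite A \<longrightarrow> finite_big_Ramsey_degree A d U d)"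

end

theory Submission
  imports Defs
begin

text \<open>Any triangle with sides in the first block is metric, whereas each larger distance \<open>s\<close> is more
  than twice every smaller one, so that \<open>d x y < s\<close> is an equivalence relation. Hence the space is
  an iterated partition into classes, with the generic edge-coloured complete graph at the bottom.
  Points are coded by tuples of words over the colours: one word names the class for each large
  distance, and the colour of an edge is the letter of the longer of two words at the position where
  the shorter one ends. An embedding of the space of parameter words acts on the codes by isometries.

  A finite subspace is a finite family of words. Such a family is obtained by substitution from
  one parameter word with boundedly many parameters, so that the Carlson--Simpson theorem for
  colourings of words with \<open>k\<close> parameters bounds the number of colours. That theorem follows by
  induction on \<open>k\<close> with a fusion argument from the case \<open>k = 0\<close>, which is proved with idempotent
  ultrafilters.\<close>

section \<open>Compact right topological semigroups\<close>

text \<open>The distance \<open>pdist\<close> reads from its words only whether they are equal,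
  which is longer, and the letter of the longer at the length of the shorter. Embeddings preserve
  exactly these data, so a single embedding acts on all coordinates of all points at once, and a
  tuple of points is merely a finite family of words. The obstacle is that infinitely many families
  code copies of one finite subspace. Envelopes leave finitely many types: a type is a number of
  parameters with a family of words to substitute, both bounded in terms of the alphabet and the
  size of the family. Because embeddings commute with substitution, each type turns a colouring of
  families into a colouring of parameter words; making all of these constant simultaneously leaves
  one colour per type. The bound is the number of types, fixed before the colouring and independent
  of the number of colours.\<close>

lemma ex_minimal_closedin:
  assumes "compact_space X" "closedin X C" "C \<noteq> {}" "P C"
    and Int: "\<And>\<F>. \<F> \<noteq> {} \<Longrightarrow> (\<And>K. K \<in> \<F> \<Longrightarrow> K \<subseteq> C \<and> P K) \<Longrightarrow> P (\<Inter>\<F>)"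
  shows "\<exists>M. M \<subseteq> C \<and> closedin X M \<and> M \<noteq> {} \<and> P M \<and>
    (\<forall>K. K \<subseteq> M \<and> closedin X K \<and> K \<noteq> {} \<and> P K \<longrightarrow> K = M)"
proof -
  let ?Q = "\<lambda>K. K \<subseteq> C \<and> closedin X K \<and> K \<noteq> {} \<and> P K"
  \<comment> \<open>Complements turn the search for a minimal set into Zorn's lemma for maximal
    sets; compactness keeps the intersection of a chain nonempty.\<close>
  have "\<exists>M\<in>uminus ` Collect ?Q. \<forall>Y\<in>uminus ` Collect ?Q. M \<subseteq> Y \<longrightarrow> Y = M"
  proof (rule subset_Zorn_nonempty)
    show "uminus ` Collect ?Q \<noteq> {}"
      using assms by blast
  next
    fix \<C> assume ne: "\<C> \<noteq> {}" and chain: "subset.chain (uminus ` Collect ?Q) \<C>"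
    define \<F> where "\<F> = uminus ` \<C>"
    have Q: "?Q K" if "K \<in> \<F>" for K
      using that chain unfolding \<F>_def subset_chain_def by fastforce
    have neF: "\<F> \<noteq> {}"
      using ne by (simp add: \<F>_def)
    have lin: "K \<subseteq> L \<or> L \<subseteq> K" if "K \<in> \<F>" "L \<in> \<F>" for K L
    proof -
      have "- K \<in> \<C>" "- L \<in> \<C>"
        using that by (auto simp: \<F>_def)
      then have "- K \<subseteq> - L \<or> - L \<subseteq> - K"
        using chain unfolding subset_chain_def by blast
      then show ?thesis
        by blast
    qed
    have fin: "\<Inter>\<G> \<noteq> {}" if "finite \<G>" "\<G> \<noteq> {}" "\<G> \<subseteq> \<F>" for \<G>
    proof -
      have "\<Inter>\<G> \<in> \<G>"
        using that
      proof (induction \<G> rule: finite_ne_induct)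
        case (insert K \<G>)
        then have "\<Inter>\<G> \<in> \<G>" "K \<in> \<F>" "\<Inter>\<G> \<in> \<F>"
          by auto
        then show ?case
          using lin[of K "\<Inter>\<G>"] by (auto simp: Int_absorb1 Int_absorb2)
      qed auto
      then show ?thesis
        using Q that(3) by blast
    qed
    have "\<Inter>\<F> \<noteq> {}"
    proof -
      have "\<forall>\<G>. finite \<G> \<longrightarrow> \<G> \<subseteq> \<F> \<longrightarrow> \<Inter>\<G> \<noteq> {}"
        using fin by (metis Inter_empty UNIV_not_empty)
      then show ?thesis
        using iffD1[OF compact_space_fip \<open>compact_space X\<close>, rule_format, of \<F>] Q by simp
    qed
    moreover have "closedin X (\<Inter>\<F>)"
      using Q neF by (intro closedin_Inter) auto
    moreover have "P (\<Inter>\<F>)"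
      using Q neF by (intro Int) auto
    ultimately have "?Q (\<Inter>\<F>)"
      using Q neF by blast
    moreover have "\<Union>\<C> = - \<Inter>\<F>"
      by (auto simp: \<F>_def)
    ultimately show "\<Union>\<C> \<in> uminus ` Collect ?Q"
      by blast
  qed
  then obtain M where M: "?Q M" "\<forall>Y\<in>uminus ` Collect ?Q. - M \<subseteq> Y \<longrightarrow> Y = - M"
    by blast
  have "K = M" if "?Q K" "K \<subseteq> M" for K
    using M(2)[rule_format, of "- K"] that by simp
  with M(1) show ?thesis
    by (intro exI[of _ M]) auto
qed

locale compact_semigroup =
  fixes X :: "'a topology" and m :: "'a \<Rightarrow> 'a \<Rightarrow> 'a"  (infixl "\<cdot>" 70)
  assumes compact: "compact_space X" and Hausdorff: "Hausdorff_space X"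
    and topspace: "topspace X = UNIV"
    and assoc: "x \<cdot> y \<cdot> z = x \<cdot> (y \<cdot> z)"
    and cont: "continuous_map X X (\<lambda>x. x \<cdot> y)"
begin

lemma closedin_image:
  assumes "closedin X K" "continuous_map X X f"
  shows "closedin X (f ` K)"
  using compactin_imp_closedin[OF Hausdorff image_compactin]
    closedin_compact_space[OF compact assms(1)] assms(2) by blast

text \<open>Ellis-Numakura: for \<open>x\<close> in a minimal closed subsemigroup \<open>M\<close>,
  the right translate of \<open>M\<close> by \<open>x\<close> is all of \<open>M\<close>. So the
  closed subsemigroup of all \<open>y\<close> with \<open>y \<cdot> x = x\<close> is nonempty, hence
  also \<open>M\<close>, and contains \<open>x\<close>.\<close>

lemma ex_idempotent:
  assumes "closedin X C" "C \<noteq> {}" "\<And>x y. x \<in> C \<Longrightarrow> y \<in> C \<Longrightarrow> x \<cdot> y \<in> C"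
  obtains x where "x \<in> C" "x \<cdot> x = x"
proof -
  let ?P = "\<lambda>K. \<forall>x\<in>K. \<forall>y\<in>K. x \<cdot> y \<in> K"
  have whole: "?P C"
    using assms by blast
  have Inter: "?P (\<Inter>\<F>)" if "\<F> \<noteq> {}" "\<And>K. K \<in> \<F> \<Longrightarrow> K \<subseteq> C \<and> ?P K" for \<F>
    using that by blast
  have "\<exists>M. M \<subseteq> C \<and> closedin X M \<and> M \<noteq> {} \<and> ?P M \<and>
    (\<forall>K. K \<subseteq> M \<and> closedin X K \<and> K \<noteq> {} \<and> ?P K \<longrightarrow> K = M)"
    using compact assms(1,2) whole Inter by (rule ex_minimal_closedin)
  then obtain M where M: "M \<subseteq> C" "closedin X M" "M \<noteq> {}" "?P M"
    and min: "\<forall>K. K \<subseteq> M \<and> closedin X K \<and> K \<noteq> {} \<and> ?P K \<longrightarrow> K = M"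
    by (elim exE conjE) (rule that)
  obtain x where x: "x \<in> M"
    using M by blast
  have "(\<lambda>y. y \<cdot> x) ` M = M"
  proof (rule min[rule_format], intro conjI)
    show "closedin X ((\<lambda>y. y \<cdot> x) ` M)"
      using M(2) cont by (rule closedin_image)
    show "\<forall>u\<in>(\<lambda>y. y \<cdot> x) ` M. \<forall>v\<in>(\<lambda>y. y \<cdot> x) ` M. u \<cdot> v \<in> (\<lambda>y. y \<cdot> x) ` M"
    proof (intro ballI)
      fix u v assume "u \<in> (\<lambda>y. y \<cdot> x) ` M" "v \<in> (\<lambda>y. y \<cdot> x) ` M"
      then obtain y z where "u = y \<cdot> x" "v = z \<cdot> x" "y \<in> M" "z \<in> M"
        by blast
      moreover have "y \<cdot> x \<cdot> (z \<cdot> x) = (y \<cdot> x \<cdot> z) \<cdot> x"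
        by (simp only: assoc)
      ultimately show "u \<cdot> v \<in> (\<lambda>y. y \<cdot> x) ` M"
        using x M(4) by simp
    qed
    show "(\<lambda>y. y \<cdot> x) ` M \<subseteq> M"
      using x M(4) by blast
    show "(\<lambda>y. y \<cdot> x) ` M \<noteq> {}"
      using M(3) by blast
  qed
  then obtain y where y: "y \<in> M" "y \<cdot> x = x"
    using x by (metis imageE)
  have "{y \<in> M. y \<cdot> x \<in> {x}} = M"
  proof (rule min[rule_format], intro conjI)
    show "closedin X {y \<in> M. y \<cdot> x \<in> {x}}"
      using cont M(2) Hausdorff topspace
      by (intro closedin_continuous_map_preimage_gen[where Y = X])
        (auto simp: closedin_Hausdorff_sing_eq)
    show "\<forall>u\<in>{y \<in> M. y \<cdot> x \<in> {x}}. \<forall>v\<in>{y \<in> M. y \<cdot> x \<in> {x}}. u \<cdot> v \<in> {y \<in> M. y \<cdot> x \<in> {x}}"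
      using M(4) by (simp add: assoc)
    show "{y \<in> M. y \<cdot> x \<in> {x}} \<noteq> {}"
      using y by blast
  qed blast
  then show ?thesis
    using x M(1) that by blast
qed

text \<open>Minimality is recorded in the form in which it acts: each element of \<open>L\<close> is
  a left multiple of every other. This makes idempotents of \<open>L\<close> right identities of
  \<open>L\<close>.\<close>

definition minimal_left_ideal :: "'a set \<Rightarrow> 'a set \<Rightarrow> bool" where
  "minimal_left_ideal C L \<longleftrightarrow> L \<subseteq> C \<and> closedin X L \<and> L \<noteq> {} \<and> (\<forall>x\<in>C. \<forall>y\<in>L. x \<cdot> y \<in> L) \<and>
     (\<forall>y\<in>L. (\<lambda>x. x \<cdot> y) ` C = L)"

lemma ex_minimal_left_ideal:
  assumes C: "closedin X C" "\<And>x y. x \<in> C \<Longrightarrow> y \<in> C \<Longrightarrow> x \<cdot> y \<in> C"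
    and I: "I \<subseteq> C" "closedin X I" "I \<noteq> {}" "\<And>x y. x \<in> C \<Longrightarrow> y \<in> I \<Longrightarrow> x \<cdot> y \<in> I"
  obtains L where "L \<subseteq> I" "minimal_left_ideal C L"
proof -
  let ?P = "\<lambda>K. \<forall>x\<in>C. \<forall>y\<in>K. x \<cdot> y \<in> K"
  have whole: "?P I"
    using I by blast
  have Inter: "?P (\<Inter>\<F>)" if "\<F> \<noteq> {}" "\<And>K. K \<in> \<F> \<Longrightarrow> K \<subseteq> I \<and> ?P K" for \<F>
    using that by blast
  have "\<exists>M. M \<subseteq> I \<and> closedin X M \<and> M \<noteq> {} \<and> ?P M \<and>
    (\<forall>K. K \<subseteq> M \<and> closedin X K \<and> K \<noteq> {} \<and> ?P K \<longrightarrow> K = M)"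
    using compact I(2,3) whole Inter by (rule ex_minimal_closedin)
  then obtain M where M: "M \<subseteq> I" "closedin X M" "M \<noteq> {}" "?P M"
    and min: "\<forall>K. K \<subseteq> M \<and> closedin X K \<and> K \<noteq> {} \<and> ?P K \<longrightarrow> K = M"
    by (elim exE conjE) (rule that)
  have "(\<lambda>x. x \<cdot> y) ` C = M" if y: "y \<in> M" for y
  proof (rule min[rule_format], intro conjI)
    show "closedin X ((\<lambda>x. x \<cdot> y) ` C)"
      using C(1) cont by (rule closedin_image)
    show "\<forall>u\<in>C. \<forall>v\<in>(\<lambda>x. x \<cdot> y) ` C. u \<cdot> v \<in> (\<lambda>x. x \<cdot> y) ` C"
    proof (intro ballI)
      fix u v assume u: "u \<in> C" and "v \<in> (\<lambda>x. x \<cdot> y) ` C"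
      then obtain x where x: "x \<in> C" "v = x \<cdot> y"
        by blast
      then have "u \<cdot> v = u \<cdot> x \<cdot> y"
        by (simp only: assoc)
      with C(2)[OF u x(1)] show "u \<cdot> v \<in> (\<lambda>x. x \<cdot> y) ` C"
        by simp
    qed
    show "(\<lambda>x. x \<cdot> y) ` C \<subseteq> M"
      using M(4) y by blast
    show "(\<lambda>x. x \<cdot> y) ` C \<noteq> {}"
      using I(1,3) by blast
  qed
  then have "minimal_left_ideal C M"
    using M I(1) by (auto simp: minimal_left_ideal_def)
  with that M(1) show ?thesis
    by blast
qed

lemma minimal_left_ideal_right_identity:
  assumes "minimal_left_ideal C L" "e \<in> L" "e \<cdot> e = e" "x \<in> L"
  shows "x \<cdot> e = x"
proof -
  obtain z where "x = z \<cdot> e"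
    using assms unfolding minimal_left_ideal_def by blast
  then show ?thesis
    using assms(3) by (simp add: assoc)
qed

end

section \<open>Ultrafilters on words\<close>

text \<open>An ultrafilter is represented by the indicator of its members, so that ultrafilters form a
  closed subset of a product of copies of \<^typ>\<open>bool\<close>.\<close>

definition ultra :: "('a set \<Rightarrow> bool) \<Rightarrow> bool" where
  "ultra x \<longleftrightarrow> x UNIV \<and> (\<forall>A B. x (A \<inter> B) \<longleftrightarrow> x A \<and> x B) \<and> (\<forall>A. x (- A) \<longleftrightarrow> \<not> x A)"

text \<open>Concatenation extended to the Stone-Cech compactification. For fixed \<open>y\<close>,
  each coordinate of the product is one coordinate of \<open>x\<close>, whence continuity in the
  left factor.\<close>

definition umul :: "('a list set \<Rightarrow> bool) \<Rightarrow> ('a list set \<Rightarrow> bool) \<Rightarrow> 'a list set \<Rightarrow> bool" where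
  "umul x y = (\<lambda>A. x {s. y {t. s @ t \<in> A}})"

definition uprincipal :: "'a \<Rightarrow> 'a set \<Rightarrow> bool" where
  "uprincipal w = (\<lambda>A. w \<in> A)"

definition umap :: "('a \<Rightarrow> 'b) \<Rightarrow> ('a set \<Rightarrow> bool) \<Rightarrow> 'b set \<Rightarrow> bool" where
  "umap f x = (\<lambda>A. x (f -` A))"

abbreviation utop :: "('a set \<Rightarrow> bool) topology" where
  "utop \<equiv> product_topology (\<lambda>_. discrete_topology UNIV) UNIV"

lemma ultra_mono: "ultra x \<Longrightarrow> x A \<Longrightarrow> A \<subseteq> B \<Longrightarrow> x B"
  unfolding ultra_def by (metis inf.absorb_iff1)

lemma ultra_Int: "ultra x \<Longrightarrow> x (A \<inter> B) \<longleftrightarrow> x A \<and> x B"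
  by (simp add: ultra_def)

lemma ultra_Compl: "ultra x \<Longrightarrow> x (- A) \<longleftrightarrow> \<not> x A"
  by (simp add: ultra_def)

lemma ultra_UNIV: "ultra x \<Longrightarrow> x UNIV"
  by (simp add: ultra_def)

lemma ultra_nonempty: "ultra x \<Longrightarrow> x A \<Longrightarrow> A \<noteq> {}"
  by (metis Compl_UNIV_eq ultra_Compl ultra_UNIV)

lemma ultra_Collect_conj: "ultra x \<Longrightarrow> x {s. P s \<and> Q s} \<longleftrightarrow> x {s. P s} \<and> x {s. Q s}"
  by (simp add: ultra_Int Collect_conj_eq)

lemma ultra_Collect_not: "ultra x \<Longrightarrow> x {s. \<not> P s} \<longleftrightarrow> \<not> x {s. P s}"
  by (simp add: ultra_Compl Collect_neg_eq)

lemma ultra_Collect_ball: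
  "finite I \<Longrightarrow> ultra x \<Longrightarrow> x {s. \<forall>i\<in>I. P i s} \<longleftrightarrow> (\<forall>i\<in>I. x {s. P i s})"
  by (induction I rule: finite_induct) (simp_all add: ultra_UNIV ultra_Int Collect_conj_eq)

lemma ultra_finite_colour:
  assumes "ultra x" "finite (range c)"
  shows "\<exists>j. x {s. c s = j}"
proof (rule ccontr)
  assume "\<nexists>j. x {s. c s = j}"
  then have "x {s. \<forall>j\<in>range c. \<not> c s = j}"
    unfolding ultra_Collect_ball[OF assms(2,1)] ultra_Collect_not[OF assms(1)] by blast
  then show False
    using ultra_nonempty[OF assms(1)] by fastforce
qed

lemma ultra_umul:
  assumes "ultra x" "ultra y"
  shows "ultra (umul x y)"
  unfolding ultra_def[of "umul x y"]
  by (simp add: umul_def assms ultra_UNIV ultra_Collect_conj[OF assms(1)] ultra_Collect_conj[OF assms(2)]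
      ultra_Collect_not[OF assms(1)] ultra_Collect_not[OF assms(2)])

lemma ultra_umap: "ultra x \<Longrightarrow> ultra (umap f x)"
  unfolding ultra_def umap_def by (simp add: vimage_Compl)

lemma ultra_uprincipal: "ultra (uprincipal w)"
  by (simp add: ultra_def uprincipal_def)

lemma umul_assoc: "umul (umul x y) z = umul x (umul y z)"
  by (simp add: umul_def)

lemma continuous_map_utop:
  assumes "\<And>A. \<exists>B. \<forall>x. f x A = x B"
  shows "continuous_map utop utop f"
proof -
  have "continuous_map utop (discrete_topology UNIV) (\<lambda>x. f x A)" for A
  proof -
    obtain B where "\<And>x. f x A = x B"
      using assms by blast
    then have "(\<lambda>x. f x A) = (\<lambda>x. x B)"
      by (rule ext)
    then show ?thesis
      using continuous_map_product_projection[OF UNIV_I, of "\<lambda>_. discrete_topology UNIV" B]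
      by (simp only:)
  qed
  then show ?thesis
    by (simp add: continuous_map_componentwise_UNIV)
qed

lemma continuous_umul_uprincipal: "continuous_map utop utop (umul (uprincipal w))"
  by (rule continuous_map_utop) (auto simp: umul_def uprincipal_def)

text \<open>Associativity and continuity hold for arbitrary indicators, so the whole product space
  serves as the semigroup; ultrafilters are cut out afterwards.\<close>

interpretation ultra: compact_semigroup utop umul
proof
  show "continuous_map utop utop (\<lambda>x. umul x y)" for y :: "'a list set \<Rightarrow> bool"
    by (rule continuous_map_utop) (auto simp: umul_def)
qed (auto simp: umul_assoc compact_space_product_topology Hausdorff_space_product_topology
    compact_space_discrete_topology)

definition word_ultras :: "nat \<Rightarrow> (nat list set \<Rightarrow> bool) set" where
  "word_ultras b = {x. ultra x \<and> x (lists {..<b})}"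

lemma closedin_utop_coord:
  "closedin utop {x. x A = v}"
  using closedin_continuous_map_preimage[OF continuous_map_product_projection, of A UNIV "\<lambda>_. discrete_topology UNIV" "{v}"]
  by simp

text \<open>Each ultrafilter axiom constrains at most three coordinates, and the coordinates are
  discrete.\<close>

lemma closedin_word_ultras: "closedin utop (word_ultras b)"
proof -
  note cl = closedin_Int closedin_Un closedin_utop_coord
  have 1: "closedin utop {x. x (A \<inter> B) \<longleftrightarrow> x A \<and> x B}" for A B :: "nat list set"
  proof -
    have "{x. x (A \<inter> B) \<longleftrightarrow> x A \<and> x B} =
       {x. x (A \<inter> B) = True} \<inter> {x. x A = True} \<inter> {x. x B = True} \<union>
       {x. x (A \<inter> B) = False} \<inter> ({x. x A = False} \<union> {x. x B = False})"
      by auto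
    moreover have "closedin utop \<dots>"
      by (intro cl)
    ultimately show ?thesis
      by simp
  qed
  have 2: "closedin utop {x. x (- A) \<longleftrightarrow> \<not> x A}" for A :: "nat list set"
  proof -
    have "{x. x (- A) \<longleftrightarrow> \<not> x A} =
       {x. x (- A) = True} \<inter> {x. x A = False} \<union>
       {x. x (- A) = False} \<inter> {x. x A = True}"
      by auto
    moreover have "closedin utop \<dots>"
      by (intro cl)
    ultimately show ?thesis
      by simp
  qed
  have "word_ultras b = {x. x UNIV = True} \<inter> {x. x (lists {..<b}) = True} \<inter>
    (\<Inter>A. \<Inter>B. {x. x (A \<inter> B) \<longleftrightarrow> x A \<and> x B}) \<inter> (\<Inter>A. {x. x (- A) \<longleftrightarrow> \<not> x A})"
    by (auto simp: word_ultras_def ultra_def)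
  also have "closedin utop \<dots>"
    by (intro closedin_Int closedin_INT closedin_utop_coord 1 2) simp_all
  finally show ?thesis .
qed

lemma umul_word_ultras: "x \<in> word_ultras b \<Longrightarrow> y \<in> word_ultras b \<Longrightarrow> umul x y \<in> word_ultras b"
proof -
  assume x: "x \<in> word_ultras b" and y: "y \<in> word_ultras b"
  have "{t. s @ t \<in> lists {..<b}} = lists {..<b}" if "s \<in> lists {..<b}" for s
    using that by auto
  then have "{s. y {t. s @ t \<in> lists {..<b}}} \<supseteq> lists {..<b}"
    using y by (simp add: word_ultras_def subset_iff)
  then have "umul x y (lists {..<b})"
    unfolding umul_def using x ultra_mono[of x "lists {..<b}"] by (auto simp: word_ultras_def)
  then show ?thesis
    using x y by (simp add: word_ultras_def ultra_umul)
qed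

lemma word_ultras_mono: "b \<le> b' \<Longrightarrow> word_ultras b \<subseteq> word_ultras b'"
  unfolding word_ultras_def using ultra_mono[of _ "lists {..<b}" "lists {..<b'}"] lists_mono[of "{..<b}" "{..<b'}"]
  by auto

lemma umap_umul: "umap (map f) (umul x y) = umul (umap (map f) x) (umap (map f) y)"
  by (simp add: umap_def umul_def vimage_def)

lemma uprincipal_in_word_ultras: "w \<in> lists {..<b} \<Longrightarrow> uprincipal w \<in> word_ultras b"
  unfolding word_ultras_def mem_Collect_eq by (rule conjI[OF ultra_uprincipal]) (simp add: uprincipal_def)

definition inst :: "nat \<Rightarrow> nat \<Rightarrow> nat list \<Rightarrow> nat list" where
  "inst b a = map (\<lambda>x. if x = b then a else x)"

lemma inst_id: "w \<in> lists {..<b} \<Longrightarrow> inst b a w = w"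
  unfolding inst_def by (induction w) auto

lemma umap_inst_umul:
  "umap (inst b a) (umul x y) = umul (umap (inst b a) x) (umap (inst b a) y)"
  unfolding inst_def by (rule umap_umul)

lemma umap_inst_word_ultras:
  assumes "x \<in> word_ultras b"
  shows "umap (inst b a) x = x"
proof
  fix A
  from assms have x: "ultra x" "x (lists {..<b})"
    by (auto simp: word_ultras_def)
  have "w \<in> inst b a -` A \<inter> lists {..<b} \<longleftrightarrow> w \<in> A \<inter> lists {..<b}" for w
    by (cases "w \<in> lists {..<b}") (simp_all add: inst_id del: in_lists_conv_set)
  then have "inst b a -` A \<inter> lists {..<b} = A \<inter> lists {..<b}"
    by (rule set_eqI)
  then have "x (inst b a -` A) \<longleftrightarrow> x A"
    using x ultra_Int by metis
  then show "umap (inst b a) x A = x A"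
    by (simp add: umap_def)
qed

lemma umap_inst_in_word_ultras:
  assumes "x \<in> word_ultras (Suc b)" "a < b"
  shows "umap (inst b a) x \<in> word_ultras b"
proof -
  have "lists {..<Suc b} \<subseteq> inst b a -` lists {..<b}"
    using \<open>a < b\<close> by (auto simp: inst_def in_lists_conv_set less_Suc_eq)
  then show ?thesis
    using assms(1) ultra_mono[of x "lists {..<Suc b}" "inst b a -` lists {..<b}"]
    by (simp add: word_ultras_def ultra_umap) (simp add: umap_def)
qed

text \<open>The ultrafilter \<open>p\<close> is a minimal idempotent of the words over \<open>b\<close> letters. Below it lies a
  minimal idempotent \<open>q\<close> of the words with a variable (the letter \<open>b\<close>), and every substitution for
  the variable sends \<open>q\<close> to \<open>p\<close>. In the minimal left ideal of \<open>q\<close> one finds an idempotent \<open>e\<close> that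
  is concentrated on words beginning with the variable.\<close>

lemma ex_variable_ultrafilter:
  obtains p e where "p \<in> word_ultras b" "ultra e" "e ((#) b ` lists {..<Suc b})"
    "\<And>a. a < b \<Longrightarrow> umul p (umap (inst b a) e) = p"
    "\<And>a a'. a < b \<Longrightarrow> a' < b \<Longrightarrow>
       umul (umap (inst b a) e) (umap (inst b a') e) = umap (inst b a) e"
proof -
  let ?S = "word_ultras b" and ?T = "word_ultras (Suc b)"
  have ST: "?S \<subseteq> ?T"
    by (rule word_ultras_mono) simp
  have "uprincipal [] \<in> ?S"
    by (rule uprincipal_in_word_ultras) simp
  then have Sne: "?S \<noteq> {}"
    by blast
  obtain L0 where L0: "L0 \<subseteq> ?S" "ultra.minimal_left_ideal ?S L0"
    using ultra.ex_minimal_left_ideal[OF closedin_word_ultras umul_word_ultras subset_refl closedin_word_ultras Sne umul_word_ultras]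
    by blast
  then have L0': "closedin utop L0" "L0 \<noteq> {}" "\<And>x y. x \<in> ?S \<Longrightarrow> y \<in> L0 \<Longrightarrow> umul x y \<in> L0"
    unfolding ultra.minimal_left_ideal_def by blast+
  obtain p where p: "p \<in> L0" "umul p p = p"
    using ultra.ex_idempotent[OF L0'(1,2)] L0'(3) L0(1) by (metis subsetD)
  have pS: "p \<in> ?S" and pT: "p \<in> ?T"
    using p L0(1) ST by blast+
  \<comment> \<open>An ideal inside \<open>?I\<close> consists of left multiples of
    \<open>p\<close>, which gives \<open>umul r p = r\<close>: one half of finding an idempotent
    below \<open>p\<close>.\<close>
  let ?I = "(\<lambda>x. umul x p) ` ?T"
  have I1: "?I \<subseteq> ?T"
    using umul_word_ultras pT by blast
  have I2: "closedin utop ?I"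
    by (rule ultra.closedin_image[OF closedin_word_ultras ultra.cont])
  have I3: "?I \<noteq> {}"
    using pT by blast
  have I4: "umul x y \<in> ?I" if x: "x \<in> ?T" and "y \<in> ?I" for x y
  proof -
    obtain z where "y = umul z p" "z \<in> ?T"
      using \<open>y \<in> ?I\<close> by blast
    then have "umul x y = umul (umul x z) p" "umul x z \<in> ?T"
      using x by (simp_all add: umul_assoc umul_word_ultras)
    then show ?thesis
      by blast
  qed
  obtain L where L: "L \<subseteq> ?I" "ultra.minimal_left_ideal ?T L"
    using ultra.ex_minimal_left_ideal[OF closedin_word_ultras umul_word_ultras I1 I2 I3 I4] by blast
  then have L': "closedin utop L" "L \<noteq> {}" "\<And>x y. x \<in> ?T \<Longrightarrow> y \<in> L \<Longrightarrow> umul x y \<in> L"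
    unfolding ultra.minimal_left_ideal_def by blast+
  have LT: "L \<subseteq> ?T"
    using L I1 by blast
  obtain r where r: "r \<in> L" "umul r r = r"
    using ultra.ex_idempotent[OF L'(1,2)] L'(3) LT by (metis subsetD)
  obtain z where "r = umul z p"
    using r L by blast
  then have rp: "umul r p = r"
    by (simp add: umul_assoc p)
  \<comment> \<open>The left factor \<open>p\<close> supplies the other half, and \<open>q\<close>
    stays in \<open>L\<close>.\<close>
  define q where "q = umul p r"
  have q: "q \<in> L" "umul q q = q" "umul q p = q" "umul p q = q"
  proof -
    show "q \<in> L"
      unfolding q_def using pT r L' by blast
    show "umul p q = q"
      unfolding q_def using p(2) by (simp flip: umul_assoc)
    show "umul q p = q"
      unfolding q_def using rp by (simp add: umul_assoc)
    have "umul q q = umul (umul q p) r"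
      unfolding q_def by (simp add: umul_assoc)
    also have "\<dots> = umul p (umul r r)"
      using \<open>umul q p = q\<close> by (simp add: q_def umul_assoc)
    finally show "umul q q = q"
      by (simp add: q_def r)
  qed
  define v where "v = uprincipal [b]"
  have vT: "v \<in> ?T"
    unfolding v_def by (rule uprincipal_in_word_ultras) simp
  \<comment> \<open>Left multiplication need not be continuous, but by a principal ultrafilter it
    is. Hence \<open>?K\<close> is closed, and its members live on words that begin with
    \<open>b\<close>.\<close>
  let ?K = "umul v ` L"
  have K1: "closedin utop ?K"
    unfolding v_def by (rule ultra.closedin_image[OF L'(1) continuous_umul_uprincipal])
  have KL: "?K \<subseteq> L"
    using vT L'(3) by blast
  have K3: "umul x y \<in> ?K" if x: "x \<in> ?K" and y: "y \<in> ?K" for x y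
  proof -
    obtain x' where x': "x = umul v x'" "x' \<in> L"
      using x by blast
    then have "umul x y = umul v (umul x' y)"
      by (simp add: umul_assoc)
    moreover have "umul x' y \<in> L"
      using x'(2) y KL LT L'(3) by blast
    ultimately show ?thesis
      by blast
  qed
  have "?K \<noteq> {}"
    using L'(2) by blast
  with K1 K3 obtain e where e: "e \<in> ?K" "umul e e = e"
    using ultra.ex_idempotent by blast
  have eL: "e \<in> L"
    using e KL by blast
  have eq: "umul e q = e" and qe: "umul q e = q"
    using ultra.minimal_left_ideal_right_identity[OF L(2)] eL e q by auto
  \<comment> \<open>The instance of \<open>q\<close> is an idempotent below \<open>p\<close>. Being
    a left multiple of \<open>p\<close> it lies in \<open>L0\<close>, where idempotents are right
    identities, so it equals \<open>p\<close>.\<close>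
  have hq: "umap (inst b a) q = p" if a: "a < b" for a
  proof -
    let ?h = "umap (inst b a)"
    have hp: "?h p = p"
      using pS by (rule umap_inst_word_ultras)
    have "?h q \<in> ?S"
      using q(1) LT a umap_inst_in_word_ultras by blast
    moreover have "umul (?h q) p = ?h q" "umul p (?h q) = ?h q" "umul (?h q) (?h q) = ?h q"
      using umap_inst_umul[of b a] hp q by metis+
    ultimately have "?h q \<in> L0"
      using L0'(3) p(1) by metis
    then have "umul p (?h q) = p"
      using ultra.minimal_left_ideal_right_identity[OF L0(2)] p(1) \<open>umul (?h q) (?h q) = ?h q\<close>
      by blast
    with \<open>umul p (?h q) = ?h q\<close> show ?thesis
      by simp
  qed
  have pe: "umul p (umap (inst b a) e) = p" if "a < b" for a
    using hq[OF that] qe umap_inst_umul by metis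
  \<comment> \<open>Substituting in \<open>umul e q = e\<close> lets a factor \<open>p\<close> be
    inserted after the first instance, and by \<open>pe\<close> that factor swallows the second
    one.\<close>
  have ee: "umul (umap (inst b a) e) (umap (inst b a') e) = umap (inst b a) e"
    if "a < b" "a' < b" for a a'
  proof -
    have "umap (inst b a) e = umul (umap (inst b a) e) p"
      using hq[OF that(1)] eq umap_inst_umul by metis
    then show ?thesis
      using pe[OF that(2)] umul_assoc by metis
  qed
  obtain y where y: "e = umul v y" "y \<in> L"
    using e by blast
  have "lists {..<Suc b} = {t. [b] @ t \<in> (#) b ` lists {..<Suc b}}"
    by auto
  moreover have "y (lists {..<Suc b})"
    using y(2) LT by (auto simp: word_ultras_def)
  ultimately have "e ((#) b ` lists {..<Suc b})"
    unfolding y(1) v_def umul_def uprincipal_def by simp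
  moreover have "ultra e"
    using eL LT by (auto simp: word_ultras_def)
  ultimately show ?thesis
    using that pS pe ee by blast
qed

section \<open>Embeddings of the space of parameter words\<close>

text \<open>Letters below \<open>b\<close> are constants, the others serve as parameters. An embedding is the
  substitution into an infinite parameter word, truncated before the first parameter that is not
  substituted; it is described by the two properties of this operation that matter.\<close>

definition emb :: "nat \<Rightarrow> (nat list \<Rightarrow> nat list) \<Rightarrow> bool" where
  "emb b \<Phi> \<longleftrightarrow> (\<forall>u a v. \<exists>r. \<Phi> (u @ a # v) = \<Phi> u @ a # r) \<and>
     (\<forall>\<sigma> u. (\<forall>x<b. \<sigma> x = x) \<longrightarrow> \<Phi> (map \<sigma> u) = map \<sigma> (\<Phi> u))"

lemma embI:
  assumes "\<And>u a v. \<exists>r. \<Phi> (u @ a # v) = \<Phi> u @ a # r"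
    and "\<And>\<sigma> u. (\<And>x. x < b \<Longrightarrow> \<sigma> x = x) \<Longrightarrow> \<Phi> (map \<sigma> u) = map \<sigma> (\<Phi> u)"
  shows "emb b \<Phi>"
  using assms by (simp add: emb_def)

lemma emb_snoc: "emb b \<Phi> \<Longrightarrow> \<exists>r. \<Phi> (u @ a # v) = \<Phi> u @ a # r"
  by (simp add: emb_def)

lemma emb_map: "emb b \<Phi> \<Longrightarrow> (\<And>x. x < b \<Longrightarrow> \<sigma> x = x) \<Longrightarrow> \<Phi> (map \<sigma> u) = map \<sigma> (\<Phi> u)"
  by (simp add: emb_def)

lemma emb_id: "emb b (\<lambda>u. u)"
  by (simp add: emb_def)

lemma emb_comp:
  assumes "emb b \<Phi>" "emb b \<Psi>"
  shows "emb b (\<lambda>u. \<Phi> (\<Psi> u))"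
proof (rule embI)
  fix u a v
  obtain r where "\<Psi> (u @ a # v) = \<Psi> u @ a # r"
    using emb_snoc[OF assms(2)] by blast
  then show "\<exists>r. \<Phi> (\<Psi> (u @ a # v)) = \<Phi> (\<Psi> u) @ a # r"
    using emb_snoc[OF assms(1)] by simp
qed (simp add: emb_map[OF assms(1)] emb_map[OF assms(2)])

text \<open>The colour selected by \<open>p\<close> survives appending any instance of an
  \<open>e\<close>-typical variable word, so variable words can be chosen one after another without
  leaving it.\<close>

lemma monochromatic_words:
  fixes c :: "nat list \<Rightarrow> nat"
  assumes "finite (range c)"
  shows "\<exists>\<Phi> j. emb b \<Phi> \<and> (\<forall>u\<in>lists {..<b}. c (\<Phi> u) = j)"
proof -
  obtain p e where p: "p \<in> word_ultras b" and e: "ultra e" "e ((#) b ` lists {..<Suc b})"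
    and pe: "\<And>a. a < b \<Longrightarrow> umul p (umap (inst b a) e) = p"
    and ee: "\<And>a a'. a < b \<Longrightarrow> a' < b \<Longrightarrow>
       umul (umap (inst b a) e) (umap (inst b a') e) = umap (inst b a) e"
    using ex_variable_ultrafilter by blast
  let ?V = "(#) b ` lists {..<Suc b}"
  have up: "ultra p" "p (lists {..<b})"
    using p by (auto simp: word_ultras_def)
  obtain j where j: "p {s. c s = j}"
    using ultra_finite_colour[OF up(1) assms] by blast
  \<comment> \<open>The second clause promises that a next variable word exists; it is what the
    recursion has to carry along.\<close>
  define good where "good s \<longleftrightarrow> c s = j \<and> (\<forall>a\<in>{..<b}. e {w. c (s @ inst b a w) = j})" for s
  have "p {s. e {w. c (s @ inst b a w) = j}}" if "a < b" for a
    using fun_cong[OF pe[OF that], of "{s. c s = j}"] j by (simp add: umul_def umap_def)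
  then have "p {s. \<forall>a\<in>{..<b}. e {w. c (s @ inst b a w) = j}}"
    by (subst ultra_Collect_ball) (use up in auto)
  then have "p {s. good s}"
    unfolding good_def using j up(1) by (simp add: ultra_Collect_conj[OF up(1)])
  then have "p ({s. good s} \<inter> lists {..<b})"
    using up ultra_Int by blast
  then obtain w0 where w0: "good w0" "w0 \<in> lists {..<b}"
    using ultra_nonempty[OF up(1)] by blast
  \<comment> \<open>Goodness is inherited because, by \<open>ee\<close>, a second instance of
    \<open>e\<close> after the first is as typical as the first alone.\<close>
  have step: "e {w. \<forall>a\<in>{..<b}. good (s @ inst b a w)}" if s: "good s" for s
  proof -
    have "e {w. c (s @ inst b a w) = j}" if "a < b" for a
      using s that by (simp add: good_def)
    moreover have "e {w. e {w'. c ((s @ inst b a w) @ inst b a' w') = j}}" if "a < b" "a' < b" for a a'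
    proof -
      have "umul (umap (inst b a) e) (umap (inst b a') e) {t. c (s @ t) = j}"
        using s that(1) by (simp add: ee[OF that] good_def) (simp add: umap_def)
      then show ?thesis
        by (simp add: umul_def umap_def)
    qed
    then have "e {w. \<forall>a'\<in>{..<b}. e {w'. c ((s @ inst b a w) @ inst b a' w') = j}}" if "a < b" for a
      by (subst ultra_Collect_ball) (use e that in auto)
    ultimately have "e {w. good (s @ inst b a w)}" if "a < b" for a
      unfolding good_def using that by (simp add: ultra_Collect_conj[OF e(1)])
    then show ?thesis
      by (subst ultra_Collect_ball) (use e in auto)
  qed
  have ex: "\<exists>w. w \<in> ?V \<and> (\<forall>s\<in>F. \<forall>a\<in>{..<b}. good (s @ inst b a w))"
    if "finite F" "\<forall>s\<in>F. good s" for F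
  proof -
    have "e {w. \<forall>s\<in>F. \<forall>a\<in>{..<b}. good (s @ inst b a w)}"
      by (subst ultra_Collect_ball) (use that e step in auto)
    then have "e (?V \<inter> {w. \<forall>s\<in>F. \<forall>a\<in>{..<b}. good (s @ inst b a w)})"
      using e ultra_Int by blast
    from ultra_nonempty[OF e(1) this] show ?thesis
      by blast
  qed
  \<comment> \<open>One variable word has to serve all words of the finite stage \<open>F\<close>,
    since it may depend on the position but not on the letters substituted so far.\<close>
  define W where "W F = (SOME w. w \<in> ?V \<and> (\<forall>s\<in>F. \<forall>a\<in>{..<b}. good (s @ inst b a w)))" for F
  define stage where "stage F = (\<lambda>(s, a). s @ inst b a (W F)) ` (F \<times> {..<b})" for F
  define F where "F n = (stage ^^ n) {w0}" for n
  have W: "W G \<in> ?V" "\<And>s a. s \<in> G \<Longrightarrow> a < b \<Longrightarrow> good (s @ inst b a (W G))"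
    if "finite G" "\<forall>s\<in>G. good s" for G
    using someI_ex[OF ex[OF that]] unfolding W_def by blast+
  have F: "finite (F n) \<and> (\<forall>s\<in>F n. good s)" for n
  proof (induction n)
    case 0
    then show ?case
      using w0 by (simp add: F_def)
  next
    case (Suc n)
    have "F (Suc n) = stage (F n)"
      by (simp add: F_def)
    then show ?case
      using Suc W(2)[of "F n"] by (auto simp: stage_def)
  qed
  define \<Phi> where "\<Phi> u = w0 @ concat (map (\<lambda>i. inst b (u ! i) (W (F i))) [0..<length u])" for u
  have Phi_snoc: "\<Phi> (u @ [a]) = \<Phi> u @ inst b a (W (F (length u)))" for u a
  proof -
    have "map (\<lambda>i. inst b ((u @ [a]) ! i) (W (F i))) [0..<length u] =
        map (\<lambda>i. inst b (u ! i) (W (F i))) [0..<length u]"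
      by (rule map_cong) (auto simp: nth_append)
    then show ?thesis
      by (simp add: \<Phi>_def del: map_eq_conv)
  qed
  have "u \<in> lists {..<b} \<Longrightarrow> \<Phi> u \<in> F (length u)" for u
  proof (induction u rule: rev_induct)
    case Nil
    then show ?case
      by (simp add: \<Phi>_def F_def)
  next
    case (snoc a u)
    then have "\<Phi> u \<in> F (length u)" "a < b"
      by auto
    then show ?case
      unfolding Phi_snoc by (auto simp: F_def stage_def)
  qed
  then have "c (\<Phi> u) = j" if "u \<in> lists {..<b}" for u
    using that F good_def by blast
  moreover have "emb b \<Phi>"
  proof (rule embI)
    fix u a v
    show "\<exists>r. \<Phi> (u @ a # v) = \<Phi> u @ a # r"
    proof (induction v rule: rev_induct)
      case Nil
      \<comment> \<open>The chosen word begins with the variable, so its instance begins with the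
        letter \<open>a\<close> itself.\<close>
      obtain t where "W (F (length u)) = b # t"
        using W(1)[of "F (length u)"] F by blast
      then show ?case
        using Phi_snoc[of u a] by (simp add: inst_def)
    next
      case (snoc x v)
      then show ?case
        using Phi_snoc[of "u @ a # v" x] by auto
    qed
  next
    fix \<sigma> :: "nat \<Rightarrow> nat" and u
    assume \<sigma>: "\<And>x. x < b \<Longrightarrow> \<sigma> x = x"
    have "map \<sigma> w0 = w0"
      using w0(2) \<sigma> by (auto intro!: map_idI)
    moreover have "map \<sigma> (inst b x (W (F n))) = inst b (\<sigma> x) (W (F n))" for x n
    proof -
      have "W (F n) \<in> lists {..<Suc b}"
        using W(1)[of "F n"] F by auto
      then show ?thesis
        using \<sigma> by (auto simp: inst_def less_Suc_eq)
    qed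
    ultimately show "\<Phi> (map \<sigma> u) = map \<sigma> (\<Phi> u)"
      by (simp add: \<Phi>_def map_concat comp_def)
         (rule arg_cong[of _ _ concat], rule map_cong, simp_all)
  qed
  ultimately show ?thesis
    by blast
qed

section \<open>Letters and tails of embedded words\<close>

lemma emb_letters:
  assumes "emb b \<Phi>"
  shows "set (\<Phi> u) \<subseteq> {..<b} \<union> set u"
proof
  fix z assume z: "z \<in> set (\<Phi> u)"
  show "z \<in> {..<b} \<union> set u"
  proof (rule ccontr)
    assume nz: "z \<notin> {..<b} \<union> set u"
    \<comment> \<open>Renaming \<open>z\<close> would change \<open>\<Phi> u\<close> but not
      \<open>u\<close>, against equivariance.\<close>
    define \<sigma> where "\<sigma> x = (if x = z then Suc z else x)" for x
    have "map \<sigma> u = u"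
      using nz by (intro map_idI) (auto simp: \<sigma>_def)
    moreover have "\<Phi> (map \<sigma> u) = map \<sigma> (\<Phi> u)"
      using nz by (intro emb_map[OF assms]) (auto simp: \<sigma>_def)
    ultimately have "z \<in> set (map \<sigma> (\<Phi> u))"
      using z by simp
    then show False
      by (auto simp: \<sigma>_def split: if_splits)
  qed
qed

lemma emb_lists: "emb b \<Phi> \<Longrightarrow> b \<le> b' \<Longrightarrow> u \<in> lists {..<b'} \<Longrightarrow> \<Phi> u \<in> lists {..<b'}"
  using emb_letters[of b \<Phi> u] by fastforce

text \<open>Letter maps fixing the first \<open>b'\<close> letters leave the prefix
  \<open>x @ [a]\<close> alone, so beyond it these letters act as constants. This peels off the
  first parameter in the inductions on \<open>k\<close>.\<close>

lemma emb_tail: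
  assumes "emb b \<Phi>" "b \<le> b'" "x \<in> lists {..<b'}" "a < b'"
  shows "\<exists>T. emb b' T \<and> (\<forall>y. \<Phi> (x @ a # y) = \<Phi> x @ a # T y)"
proof -
  define T where "T y = drop (Suc (length (\<Phi> x))) (\<Phi> (x @ a # y))" for y
  have eq: "\<Phi> (x @ a # y) = \<Phi> x @ a # T y" for y
    using emb_snoc[OF assms(1), of x a y] by (auto simp: T_def)
  have "emb b' T"
  proof (rule embI)
    fix u c v
    obtain r where "\<Phi> ((x @ a # u) @ c # v) = \<Phi> (x @ a # u) @ c # r"
      using emb_snoc[OF assms(1)] by blast
    then show "\<exists>r. T (u @ c # v) = T u @ c # r"
      using eq[of u] eq[of "u @ c # v"] by simp
  next
    fix \<sigma> u assume \<sigma>: "\<And>x. x < b' \<Longrightarrow> \<sigma> x = x"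
    then have "map \<sigma> (x @ a # u) = x @ a # map \<sigma> u"
      using assms(3,4) by (auto intro!: map_idI)
    moreover have "\<Phi> (map \<sigma> (x @ a # u)) = map \<sigma> (\<Phi> (x @ a # u))"
      using \<sigma> assms(2) by (intro emb_map[OF assms(1)]) auto
    ultimately show "T (map \<sigma> u) = map \<sigma> (T u)"
      unfolding T_def by (simp add: drop_map)
  qed
  with eq show ?thesis
    by blast
qed

text \<open>\<open>param_word b k u\<close>: the word \<open>u\<close> has exactly \<open>k\<close> parameters \<open>b, \<dots>, b + k - 1\<close>, and their first
  occurrences come in this order.\<close>

fun param_word :: "nat \<Rightarrow> nat \<Rightarrow> nat list \<Rightarrow> bool" where
  "param_word b 0 u \<longleftrightarrow> u \<in> lists {..<b}"
| "param_word b (Suc k) u \<longleftrightarrow> (\<exists>x y. u = x @ b # y \<and> x \<in> lists {..<b} \<and> param_word (Suc b) k y)"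

lemma param_word_emb: "emb b \<Phi> \<Longrightarrow> param_word b k u \<Longrightarrow> param_word b k (\<Phi> u)"
proof (induction k arbitrary: b u \<Phi>)
  case 0
  then show ?case
    using emb_lists by auto
next
  case (Suc k)
  then obtain x y where xy: "u = x @ b # y" "x \<in> lists {..<b}" "param_word (Suc b) k y"
    by auto
  have "x \<in> lists {..<Suc b}"
    using xy(2) lists_mono[of "{..<b}" "{..<Suc b}"] by auto
  then obtain T where T: "emb (Suc b) T" "\<Phi> (x @ b # y) = \<Phi> x @ b # T y" for y
    using emb_tail[OF Suc.prems(1), of "Suc b" x b] by auto
  have "param_word (Suc b) k (T y)"
    using Suc.IH T xy by blast
  moreover have "\<Phi> x \<in> lists {..<b}"
    using emb_lists[OF Suc.prems(1)] xy by blast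
  ultimately show ?case
    using T(2)[of y] xy(1) by auto
qed

lemma param_word_upt: "param_word b k [b..<b + k]"
proof (induction k arbitrary: b)
  case (Suc k)
  have "[b..<b + Suc k] = [] @ b # [Suc b..<Suc b + k]"
    by (simp add: upt_conv_Cons)
  with Suc[of "Suc b"] show ?case
    by (metis param_word.simps(2) lists.Nil)
qed simp

text \<open>\<open>lift b n Z\<close> applies the embedding \<open>Z\<close> beyond position \<open>n\<close>, with the letter at position \<open>n\<close>
  in the role of the additional constant \<open>b\<close> of \<open>Z\<close>.\<close>

definition up :: "nat \<Rightarrow> nat \<Rightarrow> nat" where
  "up b x = (if x < b then x else Suc x)"

definition down :: "nat \<Rightarrow> nat \<Rightarrow> nat \<Rightarrow> nat" where
  "down b a x = (if x < b then x else if x = b then a else x - 1)"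

definition specialise :: "nat \<Rightarrow> (nat list \<Rightarrow> nat list) \<Rightarrow> nat \<Rightarrow> nat list \<Rightarrow> nat list" where
  "specialise b Z a y = map (down b a) (Z (map (up b) y))"

definition lift :: "nat \<Rightarrow> nat \<Rightarrow> (nat list \<Rightarrow> nat list) \<Rightarrow> nat list \<Rightarrow> nat list" where
  "lift b n Z u =
     (if length u \<le> n then u else take (Suc n) u @ specialise b Z (u ! n) (drop (Suc n) u))"

lemma down_up: "down b a (up b x) = x"
  by (auto simp: down_def up_def)

lemma specialise_snoc:
  assumes "emb (Suc b) Z"
  shows "\<exists>r. specialise b Z a (u @ c # v) = specialise b Z a u @ c # r"
  using emb_snoc[OF assms, of "map (up b) u" "up b c" "map (up b) v"]
  by (auto simp: specialise_def down_up)

lemma specialise_map: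
  assumes Z: "emb (Suc b) Z" and \<sigma>: "\<And>x. x < b \<Longrightarrow> \<sigma> x = x"
  shows "specialise b Z (\<sigma> a) (map \<sigma> y) = map \<sigma> (specialise b Z a y)"
proof -
  \<comment> \<open>\<open>\<tau>\<close> is \<open>\<sigma>\<close> conjugated by the shift. It
    fixes the placeholder \<open>b\<close>, so \<open>Z\<close> commutes with it;
    \<open>down b (\<sigma> a)\<close> then sends the placeholder to
    \<open>\<sigma> a\<close>.\<close>
  define \<tau> where "\<tau> x = (if x \<le> b then x else up b (\<sigma> (x - 1)))" for x
  have 1: "map (up b) (map \<sigma> y) = map \<tau> (map (up b) y)"
    using \<sigma> by (simp add: \<tau>_def up_def)
  have 2: "Z (map \<tau> (map (up b) y)) = map \<tau> (Z (map (up b) y))"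
    by (rule emb_map[OF Z]) (simp add: \<tau>_def)
  moreover have "down b (\<sigma> a) (\<tau> x) = \<sigma> (down b a x)" for x
    using \<sigma> down_up by (auto simp: \<tau>_def) (auto simp: down_def)
  then show ?thesis
    unfolding specialise_def 1 2 by simp
qed

text \<open>\<open>down b b\<close> fixes the constants of \<open>Z\<close>, including
  \<open>b\<close>, so it passes through \<open>Z\<close> and cancels the shift. Thus on
  \<open>x @ b # y\<close> with \<open>length x = n\<close>, \<open>lift b n Z\<close> applies
  \<open>Z\<close> itself to \<open>y\<close>.\<close>

lemma specialise_self:
  assumes "emb (Suc b) Z"
  shows "specialise b Z b y = Z y"
proof -
  have "map (down b b) (Z (map (up b) y)) = Z (map (down b b) (map (up b) y))"
    by (rule emb_map[OF assms, symmetric]) (auto simp: down_def)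
  then show ?thesis
    by (simp add: specialise_def down_up comp_def)
qed

lemma emb_lift:
  assumes Z: "emb (Suc b) Z"
  shows "emb b (lift b n Z)"
proof (rule embI)
  fix u a v
  show "\<exists>r. lift b n Z (u @ a # v) = lift b n Z u @ a # r"
  proof (cases "length u \<le> n")
    case True
    then have "take (Suc n) (u @ a # v) = u @ a # take (n - length u) v"
      by (simp add: Suc_diff_le)
    with True show ?thesis
      by (auto simp: lift_def)
  next
    case False
    then obtain r where
      "specialise b Z (u ! n) (drop (Suc n) u @ a # v) = specialise b Z (u ! n) (drop (Suc n) u) @ a # r"
      using specialise_snoc[OF Z] by blast
    with False show ?thesis
      by (auto simp: lift_def nth_append)
  qed
next
  fix \<sigma> u assume "\<And>x. x < b \<Longrightarrow> \<sigma> x = x"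
  then show "lift b n Z (map \<sigma> u) = map \<sigma> (lift b n Z u)"
    using specialise_map[OF Z] by (simp add: lift_def take_map drop_map)
qed

section \<open>A Ramsey theorem for parameter words\<close>

definition word_ramsey :: "nat \<Rightarrow> nat \<Rightarrow> bool" where
  "word_ramsey b k \<longleftrightarrow> (\<forall>c::nat list \<Rightarrow> nat. finite (range c) \<longrightarrow>
     (\<exists>\<Phi> j. emb b \<Phi> \<and> (\<forall>u. param_word b k u \<longrightarrow> c (\<Phi> u) = j)))"

text \<open>Colourings can be treated in turn: a further embedding maps parameter words to parameter
  words and so keeps the colours already made constant.\<close>

lemma word_ramsey_simultaneous:
  fixes c :: "'i \<Rightarrow> nat list \<Rightarrow> nat"
  assumes "finite I" "\<And>i. i \<in> I \<Longrightarrow> word_ramsey b (\<kappa> i)" "\<And>i. i \<in> I \<Longrightarrow> finite (range (c i))"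
  shows "\<exists>\<Phi>. emb b \<Phi> \<and> (\<forall>i\<in>I. \<exists>j. \<forall>u. param_word b (\<kappa> i) u \<longrightarrow> c i (\<Phi> u) = j)"
  using assms
proof (induction I rule: finite_induct)
  case empty
  then show ?case
    using emb_id by blast
next
  case (insert i I)
  then obtain \<Phi> where \<Phi>: "emb b \<Phi>" "\<forall>i\<in>I. \<exists>j. \<forall>u. param_word b (\<kappa> i) u \<longrightarrow> c i (\<Phi> u) = j"
    by auto
  have "finite (range (\<lambda>u. c i (\<Phi> u)))"
    using insert.prems(2)[of i] by (auto intro: finite_subset[rotated])
  then obtain \<Psi> j where \<Psi>: "emb b \<Psi>" "\<forall>u. param_word b (\<kappa> i) u \<longrightarrow> c i (\<Phi> (\<Psi> u)) = j"
    using insert.prems(1)[of i] unfolding word_ramsey_def by blast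
  have "\<forall>i'\<in>insert i I. \<exists>j. \<forall>u. param_word b (\<kappa> i') u \<longrightarrow> c i' (\<Phi> (\<Psi> u)) = j"
    using \<Phi>(2) \<Psi>(2) param_word_emb[OF \<Psi>(1)] by (metis insert_iff)
  then show ?case
    using emb_comp[OF \<Phi>(1) \<Psi>(1)] by blast
qed

lemma word_ramsey_0: "word_ramsey b 0"
  unfolding word_ramsey_def using monochromatic_words[of _ b] by (simp add: Ball_def)

text \<open>The first parameter of a word with \<open>k + 1\<close> parameters becomes a constant for the part of the
  word that follows it. A fusion makes the colour independent of that part, and what remains is a
  colouring of words without parameters.\<close>

lemma word_ramsey_Suc:
  assumes IH: "word_ramsey (Suc b) k"
  shows "word_ramsey b (Suc k)"
  unfolding word_ramsey_def
proof (intro allI impI)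
  fix c :: "nat list \<Rightarrow> nat" assume c: "finite (range c)"
  \<comment> \<open>Stage \<open>n\<close> handles the finitely many prefixes of length
    \<open>n\<close> together, for the colouring as already modified by
    \<open>\<Phi>\<close>.\<close>
  let ?X = "\<lambda>n. {x \<in> lists {..<b}. length x = n}"
  let ?Q = "\<lambda>n \<Phi> Z. emb (Suc b) Z \<and>
    (\<forall>x\<in>?X n. \<exists>j. \<forall>y. param_word (Suc b) k y \<longrightarrow> c (\<Phi> (x @ b # Z y)) = j)"
  have exZ: "\<exists>Z. ?Q n \<Phi> Z" for n and \<Phi> :: "nat list \<Rightarrow> nat list"
  proof (rule word_ramsey_simultaneous)
    have "?X n = {xs. set xs \<subseteq> {..<b} \<and> length xs = n}"
      by auto
    then show "finite (?X n)"
      using finite_lists_length_eq[of "{..<b}" n] by simp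
    show "finite (range (\<lambda>y. c (\<Phi> (x @ b # y))))" for x
      using c by (rule finite_subset[rotated]) auto
  qed (rule IH)
  define Z where "Z n \<Phi> = (SOME Z. ?Q n \<Phi> Z)" for n \<Phi>
  have Z: "?Q n \<Phi> (Z n \<Phi>)" for n \<Phi>
    unfolding Z_def using exZ by (rule someI_ex)
  \<comment> \<open>The factor added at stage \<open>n\<close> fixes all words of length at most
    \<open>n\<close>, so the composites stabilise on each word.\<close>
  define \<Phi> where "\<Phi> = rec_nat (\<lambda>u. u) (\<lambda>n \<Phi> u. \<Phi> (lift b n (Z n \<Phi>) u))"
  have \<Phi>_0: "\<Phi> 0 u = u" and \<Phi>_Suc: "\<Phi> (Suc n) u = \<Phi> n (lift b n (Z n (\<Phi> n)) u)" for n u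
    by (simp_all add: \<Phi>_def)
  have emb_lift_Z: "emb b (lift b n (Z n (\<Phi> n)))" for n
    using Z emb_lift by blast
  have emb_\<Phi>: "emb b (\<Phi> n)" for n
  proof (induction n)
    case 0
    have "\<Phi> 0 = (\<lambda>u. u)"
      using \<Phi>_0 by (rule ext)
    then show ?case
      using emb_id by simp
  next
    case (Suc n)
    have "\<Phi> (Suc n) = (\<lambda>u. \<Phi> n (lift b n (Z n (\<Phi> n)) u))"
      using \<Phi>_Suc by (rule ext)
    then show ?case
      using emb_comp[OF Suc emb_lift_Z] by simp
  qed
  define \<Phi>' where "\<Phi>' u = \<Phi> (length u) u" for u
  have stable: "\<Phi>' u = \<Phi> n u" if "length u \<le> n" for u n
    using that
  proof (induction n rule: dec_induct)
    case (step n)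
    then have "lift b n (Z n (\<Phi> n)) u = u"
      by (simp add: lift_def)
    then show ?case
      using step by (simp add: \<Phi>_Suc)
  qed (simp add: \<Phi>'_def)
  have emb_\<Phi>': "emb b \<Phi>'"
  proof (rule embI)
    fix u a v
    have "\<Phi>' (u @ a # v) = \<Phi> (length (u @ a # v)) (u @ a # v)"
      "\<Phi>' u = \<Phi> (length (u @ a # v)) u"
      by (rule stable; simp)+
    then show "\<exists>r. \<Phi>' (u @ a # v) = \<Phi>' u @ a # r"
      using emb_snoc[OF emb_\<Phi>] by simp
  next
    fix \<sigma> u assume "\<And>x. x < b \<Longrightarrow> \<sigma> x = x"
    then show "\<Phi>' (map \<sigma> u) = map \<sigma> (\<Phi>' u)"
      using emb_map[OF emb_\<Phi>] by (simp add: \<Phi>'_def)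
  qed
  have const: "\<exists>j. \<forall>y. param_word (Suc b) k y \<longrightarrow> c (\<Phi>' (x @ b # y)) = j" if x: "x \<in> lists {..<b}" for x
  proof -
    let ?n = "length x"
    obtain j where j: "\<And>y. param_word (Suc b) k y \<Longrightarrow> c (\<Phi> ?n (x @ b # Z ?n (\<Phi> ?n) y)) = j"
      using Z[of ?n "\<Phi> ?n"] x by blast
    \<comment> \<open>Stage \<open>length x\<close> fixes the colour; later factors keep
      \<open>x @ [b]\<close> and only replace \<open>y\<close> by another parameter word.\<close>
    have "c (\<Phi> m (x @ b # y)) = j" if "Suc ?n \<le> m" "param_word (Suc b) k y" for m y
      using that
    proof (induction m arbitrary: y rule: dec_induct)
      case base
      then show ?case
        using j specialise_self Z by (simp add: \<Phi>_Suc lift_def)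
    next
      case (step m)
      have "x \<in> lists {..<Suc b}"
        using x lists_mono[of "{..<b}" "{..<Suc b}"] by auto
      then obtain T where T: "emb (Suc b) T"
        "\<And>y. lift b m (Z m (\<Phi> m)) (x @ b # y) = lift b m (Z m (\<Phi> m)) x @ b # T y"
        using emb_tail[OF emb_lift_Z, of "Suc b" x b m] by auto
      moreover have "lift b m (Z m (\<Phi> m)) x = x"
        using step by (simp add: lift_def)
      ultimately have "\<Phi> (Suc m) (x @ b # y) = \<Phi> m (x @ b # T y)"
        by (simp add: \<Phi>_Suc)
      moreover have "param_word (Suc b) k (T y)"
        using T(1) step.prems by (rule param_word_emb)
      ultimately show ?case
        using step.IH by simp
    qed
    then show ?thesis
      by (auto simp: \<Phi>'_def)
  qed
  define g where "g x = c (\<Phi>' (x @ b # [Suc b..<Suc b + k]))" for x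
  have g: "c (\<Phi>' (x @ b # y)) = g x" if "x \<in> lists {..<b}" "param_word (Suc b) k y" for x y
    using const[OF that(1)] that(2) param_word_upt[of "Suc b" k] unfolding g_def by metis
  have "finite (range g)"
    using c by (rule finite_subset[rotated]) (auto simp: g_def)
  then obtain \<Psi> j where \<Psi>: "emb b \<Psi>" "\<And>x. x \<in> lists {..<b} \<Longrightarrow> g (\<Psi> x) = j"
    using monochromatic_words by blast
  have "c (\<Phi>' (\<Psi> u)) = j" if "param_word b (Suc k) u" for u
  proof -
    obtain x y where xy: "u = x @ b # y" "x \<in> lists {..<b}" "param_word (Suc b) k y"
      using \<open>param_word b (Suc k) u\<close> by auto
    have "x \<in> lists {..<Suc b}"
      using xy(2) lists_mono[of "{..<b}" "{..<Suc b}"] by auto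
    then obtain T where T: "emb (Suc b) T" "\<And>y. \<Psi> (x @ b # y) = \<Psi> x @ b # T y"
      using emb_tail[OF \<Psi>(1), of "Suc b" x b] by auto
    have "\<Psi> x \<in> lists {..<b}"
      using emb_lists[OF \<Psi>(1)] xy by blast
    then show ?thesis
      using g[of "\<Psi> x" "T y"] T param_word_emb[OF T(1) xy(3)] \<Psi>(2) xy by simp
  qed
  then show "\<exists>\<Phi> j. emb b \<Phi> \<and> (\<forall>u. param_word b (Suc k) u \<longrightarrow> c (\<Phi> u) = j)"
    using emb_comp[OF emb_\<Phi>' \<Psi>(1)] by blast
qed

theorem word_ramsey: "word_ramsey b k"
  by (induction k arbitrary: b) (auto intro: word_ramsey_0 word_ramsey_Suc)

section \<open>Envelopes\<close>

lemma param_word_letters: "param_word b k u \<Longrightarrow> u \<in> lists {..<b + k}"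
proof (induction k arbitrary: b u)
  case (Suc k)
  then obtain x y where "u = x @ b # y" "x \<in> lists {..<b}" "y \<in> lists {..<Suc b + k}"
    by (metis param_word.simps(2))
  then show ?case
    by (auto simp: less_imp_le_nat trans_less_add1)
qed simp

lemma param_word_split: "param_word b k u \<Longrightarrow> l < k \<Longrightarrow> \<exists>u1 u2. u = u1 @ (b + l) # u2 \<and> u1 \<in> lists {..<b + l}"
proof (induction k arbitrary: b u l)
  case (Suc k)
  then obtain x y where xy: "u = x @ b # y" "x \<in> lists {..<b}" "param_word (Suc b) k y"
    by auto
  show ?case
  proof (cases l)
    case 0
    then show ?thesis
      using xy by auto
  next
    case (Suc l')
    then obtain y1 y2 where "y = y1 @ (Suc b + l') # y2" "y1 \<in> lists {..<Suc b + l'}"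
      using Suc.IH[OF xy(3), of l'] \<open>l < Suc k\<close> by auto
    then show ?thesis
      using xy(1,2) Suc by (intro exI[of _ "x @ b # y1"] exI[of _ y2]) (auto simp: trans_less_add1)
  qed
qed simp

lemma param_word_snoc_old: "param_word b k u \<Longrightarrow> x < b + k \<Longrightarrow> param_word b k (u @ [x])"
proof (induction k arbitrary: b u)
  case (Suc k)
  then obtain v y where vy: "u = v @ b # y" "v \<in> lists {..<b}" "param_word (Suc b) k y"
    by auto
  then have "param_word (Suc b) k (y @ [x])"
    using Suc by simp
  with vy show ?case
    by auto
qed simp

lemma param_word_snoc_new: "param_word b k u \<Longrightarrow> param_word b (Suc k) (u @ [b + k])"
proof (induction k arbitrary: b u)
  case (Suc k)
  then obtain v y where vy: "u = v @ b # y" "v \<in> lists {..<b}" "param_word (Suc b) k y"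
    by auto
  then have "param_word (Suc b) (Suc k) (y @ [Suc b + k])"
    using Suc.IH by blast
  with vy show ?case
    by (subst param_word.simps) (auto simp del: param_word.simps)
qed auto

text \<open>Distinct letters of \<open>z\<close> are numbered by first occurrence. Injectivity of
  \<open>h\<close> makes \<open>k\<close> their number, which is how \<open>k\<close> gets bounded
  in the envelope.\<close>

lemma parametrise:
  "\<exists>u k h. param_word b k u \<and> set u \<subseteq> {b..<b + k} \<and> z = map h u \<and> inj_on h {b..<b + k} \<and>
     h ` {b..<b + k} = set z"
proof (induction z rule: rev_induct)
  case Nil
  have "param_word b 0 []"
    by simp
  then show ?case
    by (intro exI[of _ "[]"] exI[of _ 0]) auto
next
  case (snoc a z)
  then obtain u k h where IH: "param_word b k u" "set u \<subseteq> {b..<b + k}" "z = map h u"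
    "inj_on h {b..<b + k}" "h ` {b..<b + k} = set z"
    by blast
  show ?case
  proof (cases "a \<in> set z")
    case True
    then obtain x where x: "x \<in> {b..<b + k}" "a = h x"
      using IH(5) by blast
    then have "param_word b k (u @ [x])"
      using IH(1) by (intro param_word_snoc_old) auto
    then show ?thesis
      using IH x True by (intro exI[of _ "u @ [x]"] exI[of _ k] exI[of _ h]) auto
  next
    case False
    let ?h = "h(b + k := a)"
    have Un: "{b..<b + Suc k} = insert (b + k) {b..<b + k}"
      by auto
    have eq: "?h x = h x" if "x \<in> {b..<b + k}" for x
      using that by auto
    have img: "?h ` {b..<b + k} = set z"
      unfolding IH(5)[symmetric] using eq by (rule image_cong[OF refl])
    have "param_word b (Suc k) (u @ [b + k])"
      using IH(1) by (rule param_word_snoc_new)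
    moreover have "set (u @ [b + k]) \<subseteq> {b..<b + Suc k}"
      using IH(2) by auto
    moreover have "z @ [a] = map ?h (u @ [b + k])"
      using IH(2,3) by auto
    moreover have "inj_on ?h {b..<b + k}"
      using IH(4) inj_on_cong[of "{b..<b + k}" ?h h] eq by blast
    then have "inj_on ?h {b..<b + Suc k}"
      unfolding Un using img False by auto
    moreover have "?h ` {b..<b + Suc k} = set (z @ [a])"
      unfolding Un image_insert img by auto
    ultimately show ?thesis
      by blast
  qed
qed

text \<open>\<open>g\<close> gives the values of the first \<open>length g\<close> parameters. As
  first occurrences come in order, the cut falls at the first occurrence of the parameter
  \<open>b + length g\<close>, if there is one.\<close>

definition subst :: "nat \<Rightarrow> nat list \<Rightarrow> nat list \<Rightarrow> nat list" where
  "subst b u g = map (\<lambda>x. if x < b then x else g ! (x - b)) (takeWhile (\<lambda>x. x < b + length g) u)"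

text \<open>Embeddings commute with letter maps by definition, and with the truncation because it
  cuts just before a first occurrence, which \<open>emb_snoc\<close> carries to one in
  \<open>\<Phi> u\<close>.\<close>

lemma emb_subst:
  assumes \<Phi>: "emb b \<Phi>" and u: "param_word b k u" and g: "length g \<le> k"
  shows "\<Phi> (subst b u g) = subst b (\<Phi> u) g"
proof -
  let ?P = "\<lambda>x. x < b + length g"
  have "\<Phi> (takeWhile ?P u) = takeWhile ?P (\<Phi> u)"
  proof (cases "length g = k")
    case True
    have tw: "takeWhile ?P w = w" if "param_word b k w" for w
      using param_word_letters[OF that] True by (intro takeWhile_eq_all_conv[THEN iffD2]) auto
    show ?thesis
      unfolding tw[OF u] tw[OF param_word_emb[OF \<Phi> u]] ..
  next
    case False
    then obtain u1 u2 where u12: "u = u1 @ (b + length g) # u2" "u1 \<in> lists {..<b + length g}"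
      using param_word_split[OF u, of "length g"] g by auto
    have tw: "takeWhile ?P (w @ (b + length g) # v) = w" if "w \<in> lists {..<b + length g}" for w v
      using that by (subst takeWhile_append2) auto
    obtain r where "\<Phi> u = \<Phi> u1 @ (b + length g) # r"
      using emb_snoc[OF \<Phi>] u12(1) by blast
    moreover have "\<Phi> u1 \<in> lists {..<b + length g}"
      using emb_lists[OF \<Phi> _ u12(2)] by simp
    ultimately show ?thesis
      using u12 tw by simp
  qed
  then show ?thesis
    unfolding subst_def by (subst emb_map[OF \<Phi>]) auto
qed

text \<open>The positions of a finite family of words are classified by the tuple of the letters that the
  words have there, the letter \<open>b\<close> standing for a word that is too short. Replacing each class by a
  parameter exhibits the family as substitution instances of one word with boundedly many
  parameters.\<close>

lemma ex_envelope:
  assumes J: "finite J" and us: "\<And>j. j \<in> J \<Longrightarrow> us j \<in> lists {..<b}"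
  shows "\<exists>k u g. k \<le> Suc b ^ card J \<and> param_word b k u \<and>
    (\<forall>j\<in>J. g j \<in> lists {..<b} \<and> length (g j) \<le> k \<and> us j = subst b u (g j))"
proof -
  define N where "N = (\<Sum>j\<in>J. length (us j))"
  have N: "length (us j) \<le> N" if "j \<in> J" for j
    unfolding N_def using J that by (intro member_le_sum) auto
  define col where "col i = (\<lambda>j\<in>J. if i < length (us j) then us j ! i else b)" for i
  have us_nth: "us j ! i < b" if "j \<in> J" "i < length (us j)" for i j
    using us[OF that(1)] that(2) by (auto simp: in_lists_conv_set)
  have col_PiE: "col i \<in> J \<rightarrow>\<^sub>E {..b}" for i
    using us_nth by (auto simp: col_def less_imp_le_nat)
  have col_less: "col i j < b \<longleftrightarrow> i < length (us j)" if "j \<in> J" for i j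
    using us_nth that by (auto simp: col_def)
  obtain u k h where param_word: "param_word b k u" and u: "set u \<subseteq> {b..<b + k}" "map col [0..<N] = map h u"
    and h: "inj_on h {b..<b + k}" "h ` {b..<b + k} = set (map col [0..<N])"
    using parametrise[of b "map col [0..<N]"] by blast
  have lenu: "length u = N"
    using arg_cong[OF u(2), of length] by simp
  have col_u: "col i = h (u ! i)" if "i < N" for i
    using arg_cong[OF u(2), of "\<lambda>z. z ! i"] that lenu by simp
  have h_PiE: "h ` {b..<b + k} \<subseteq> J \<rightarrow>\<^sub>E {..b}"
    unfolding h(2) using col_PiE by auto
  have "k = card (h ` {b..<b + k})"
    using h(1) by (simp add: card_image)
  also have "\<dots> \<le> card (J \<rightarrow>\<^sub>E {..b})"
    using J h_PiE by (intro card_mono finite_PiE) auto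
  finally have k: "k \<le> Suc b ^ card J"
    using J by (simp add: card_PiE)
  \<comment> \<open>The first class on which word \<open>j\<close> is already over, or
    \<open>k\<close> if there is none. Classes are numbered by first occurrence, so this class first
    appears at position \<open>length (us j)\<close>, where the substitution has to stop.\<close>
  define l where "l j = (LEAST q. q = k \<or> \<not> h (b + q) j < b)" for j
  have l: "l j \<le> k" "l j < k \<Longrightarrow> \<not> h (b + l j) j < b" "\<And>q. q < l j \<Longrightarrow> h (b + q) j < b" for j
  proof -
    let ?P = "\<lambda>q. q = k \<or> \<not> h (b + q) j < b"
    have "?P k"
      by simp
    then show "l j \<le> k"
      unfolding l_def by (rule Least_le)
    have "?P (l j)"
      unfolding l_def using \<open>?P k\<close> by (rule LeastI)
    then show "\<not> h (b + l j) j < b" if "l j < k"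
      using that by blast
    show "h (b + q) j < b" if "q < l j" for q
      using not_less_Least[of q ?P] that unfolding l_def by blast
  qed
  define g where "g j = map (\<lambda>q. h (b + q) j) [0..<l j]" for j
  have "g j \<in> lists {..<b} \<and> length (g j) \<le> k \<and> us j = subst b u (g j)" if j: "j \<in> J" for j
  proof (intro conjI)
    show "g j \<in> lists {..<b}" "length (g j) \<le> k"
      using l by (auto simp: g_def)
    define u1 where "u1 = takeWhile (\<lambda>x. x < b + l j) u"
    have nth_u1: "u1 ! i = u ! i" "i < N" "b \<le> u ! i" "u ! i < b + l j" if "i < length u1" for i
    proof -
      show 1: "u1 ! i = u ! i"
        using that unfolding u1_def by (rule takeWhile_nth)
      show 2: "i < N"
        using that length_takeWhile_le[of _ u] lenu unfolding u1_def by (metis order_less_le_trans)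
      show "b \<le> u ! i"
        using u(1) 2 lenu nth_mem by fastforce
      show "u ! i < b + l j"
        using that 1 nth_mem[OF that] set_takeWhileD unfolding u1_def by metis
    qed
    have nth_us: "i < length (us j)" "us j ! i = h (u ! i) j" if "i < length u1" for i
    proof -
      have "h (b + (u ! i - b)) j < b"
        using nth_u1[OF that] by (intro l(3)) auto
      then have "col i j < b"
        using nth_u1[OF that] by (simp add: col_u)
      then show "i < length (us j)"
        using col_less j by blast
      then show "us j ! i = h (u ! i) j"
        using fun_cong[OF col_u[OF nth_u1(2)[OF that]], of j] j by (simp add: col_def)
    qed
    have "length (us j) \<le> length u1"
    proof (cases "l j < k")
      case True
      then obtain u1' u2 where u12: "u = u1' @ (b + l j) # u2" "u1' \<in> lists {..<b + l j}"
        using param_word_split[OF param_word] by blast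
      then have "u1 = u1'"
        unfolding u1_def by (subst u12(1), subst takeWhile_append2) auto
      then have "length u1 < N" "u ! length u1 = b + l j"
        using u12(1) lenu by auto
      then have "\<not> col (length u1) j < b"
        using l(2)[OF True] col_u by simp
      then show ?thesis
        using col_less[OF j] by auto
    next
      case False
      then have "l j = k"
        using l(1)[of j] by simp
      then have "u1 = u"
        using u(1) unfolding u1_def by (intro takeWhile_eq_all_conv[THEN iffD2]) auto
      then show ?thesis
        using N[OF j] lenu by simp
    qed
    then have len: "length (us j) = length u1"
      using nth_us(1) by (meson le_neq_implies_less nat_less_le order_less_irrefl)
    have "subst b u (g j) = map (\<lambda>x. if x < b then x else g j ! (x - b)) u1"
      by (simp add: subst_def g_def u1_def)
    also have "\<dots> = us j"
    proof (rule nth_equalityI)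
      fix i assume "i < length (map (\<lambda>x. if x < b then x else g j ! (x - b)) u1)"
      then have i: "i < length u1"
        by simp
      show "map (\<lambda>x. if x < b then x else g j ! (x - b)) u1 ! i = us j ! i"
        using nth_u1[OF i] nth_us[OF i] i by (simp add: g_def less_diff_conv2)
    qed (simp add: len)
    finally show "us j = subst b u (g j)"
      by simp
  qed
  with k param_word show ?thesis
    by blast
qed

theorem finite_colours_of_families:
  fixes J :: "'j set"
  assumes J: "finite J"
  shows "\<exists>t. \<forall>C::('j \<Rightarrow> nat list) \<Rightarrow> nat. finite (range C) \<longrightarrow>
    (\<exists>\<Phi>. emb b \<Phi> \<and> card ((\<lambda>us. C (\<lambda>j\<in>J. \<Phi> (us j))) ` (J \<rightarrow> lists {..<b})) \<le> t)"
proof -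
  define K where "K = Suc b ^ card J"
  \<comment> \<open>The types. \<open>K\<close> also bounds the lengths, since no more letters are
    substituted than there are parameters.\<close>
  define I where "I = {..K} \<times> (J \<rightarrow>\<^sub>E {w. set w \<subseteq> {..<b} \<and> length w \<le> K})"
  have I: "finite I"
    unfolding I_def using J finite_lists_length_le[of "{..<b}" K] by (intro finite_cartesian_product finite_PiE) auto
  have "\<exists>\<Phi>. emb b \<Phi> \<and> card ((\<lambda>us. C (\<lambda>j\<in>J. \<Phi> (us j))) ` (J \<rightarrow> lists {..<b})) \<le> card I"
    if C: "finite (range C)" for C :: "('j \<Rightarrow> nat list) \<Rightarrow> nat"
  proof -
    define c where "c i u = C (\<lambda>j\<in>J. subst b u (snd i j))" for i :: "nat \<times> ('j \<Rightarrow> nat list)" and u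
    have "finite (range (c i))" for i
      using C by (rule finite_subset[rotated]) (auto simp: c_def)
    then obtain \<Phi> where \<Phi>: "emb b \<Phi>" "\<forall>i\<in>I. \<exists>m. \<forall>u. param_word b (fst i) u \<longrightarrow> c i (\<Phi> u) = m"
      using word_ramsey_simultaneous[OF I word_ramsey, of c b fst] by auto
    then obtain m where m: "\<And>i u. i \<in> I \<Longrightarrow> param_word b (fst i) u \<Longrightarrow> c i (\<Phi> u) = m i"
      by metis
    have "C (\<lambda>j\<in>J. \<Phi> (us j)) \<in> m ` I" if us: "us \<in> J \<rightarrow> lists {..<b}" for us
    proof -
      obtain k u g where k: "k \<le> K" and u: "param_word b k u"
        and g: "\<And>j. j \<in> J \<Longrightarrow> g j \<in> lists {..<b} \<and> length (g j) \<le> k \<and> us j = subst b u (g j)"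
        using ex_envelope[OF J, of us b] us unfolding K_def by blast
      let ?i = "(k, restrict g J)"
      have "(\<lambda>j\<in>J. \<Phi> (us j)) = (\<lambda>j\<in>J. subst b (\<Phi> u) (snd ?i j))"
        using g emb_subst[OF \<Phi>(1) u] by (intro restrict_ext) auto
      then have "C (\<lambda>j\<in>J. \<Phi> (us j)) = c ?i (\<Phi> u)"
        by (simp add: c_def)
      moreover have "?i \<in> I"
        using k g by (auto simp: I_def in_lists_conv_set intro: order_trans)
      ultimately show ?thesis
        using m[of ?i u] u by auto
    qed
    then have "(\<lambda>us. C (\<lambda>j\<in>J. \<Phi> (us j))) ` (J \<rightarrow> lists {..<b}) \<subseteq> m ` I"
      by blast
    then have "card ((\<lambda>us. C (\<lambda>j\<in>J. \<Phi> (us j))) ` (J \<rightarrow> lists {..<b})) \<le> card I"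
      using I by (meson card_image_le card_mono finite_imageI order_trans)
    with \<Phi>(1) show ?thesis
      by blast
  qed
  then show ?thesis
    by blast
qed

section \<open>Isometric embeddings\<close>

definition isometric_on :: "'a set \<Rightarrow> ('a \<Rightarrow> 'a \<Rightarrow> real) \<Rightarrow> 'b set \<Rightarrow> ('b \<Rightarrow> 'b \<Rightarrow> real) \<Rightarrow> ('a \<Rightarrow> 'b) \<Rightarrow> bool" where
  "isometric_on M d N e f \<longleftrightarrow> f ` M \<subseteq> N \<and> (\<forall>x\<in>M. \<forall>y\<in>M. e (f x) (f y) = d x y)"

lemma isometric_on_comp:
  "isometric_on L c M d f \<Longrightarrow> isometric_on M d N e g \<Longrightarrow> isometric_on L c N e (\<lambda>x. g (f x))"
  unfolding isometric_on_def by (auto simp: image_subset_iff)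

lemma isometric_on_subset:
  "isometric_on M d N e f \<Longrightarrow> L \<subseteq> M \<Longrightarrow> isometric_on L d N e f"
  unfolding isometric_on_def by blast

lemma isometric_on_imp_isometry:
  assumes "Metric_space M d" "Metric_space N e" "isometric_on M d N e f"
  shows "isometry M d (f ` M) e f"
proof -
  have "inj_on f M"
  proof (rule inj_onI)
    fix x y assume xy: "x \<in> M" "y \<in> M" "f x = f y"
    have "d x y = e (f x) (f y)"
      using assms(3) xy(1,2) unfolding isometric_on_def by metis
    also have "\<dots> = 0"
      using assms(3) xy Metric_space.zero[OF assms(2), of "f y" "f y"]
      by (simp add: isometric_on_def image_subset_iff)
    finally show "x = y"
      using Metric_space.zero[OF assms(1)] xy by blast
  qed
  then show ?thesis
    using assms(3) by (simp add: isometry_def isometric_on_def bij_betw_def)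
qed

text \<open>Universality places \<open>E\<close> somewhere in \<open>U\<close>; ultrahomogeneity
  then moves the copy of \<open>E'\<close> to where \<open>h\<close> has put it.\<close>

lemma Urysohn_extension:
  assumes U: "countable_Urysohn S U d" and M: "metric_space_over S M e" "countable M"
    and E: "finite E" "E \<subseteq> M" and E': "E' \<subseteq> E" and h: "isometric_on E' e U d h"
  shows "\<exists>h'. isometric_on E e U d h' \<and> (\<forall>x\<in>E'. h' x = h x)"
proof -
  have MU: "Metric_space U d" and hom: "ultrahomogeneous U d"
    and univ: "\<And>(A::nat set) e. finite A \<Longrightarrow> metric_space_over S A e \<Longrightarrow> \<exists>F\<subseteq>U. isometric A e F d"
    using U by (auto simp: countable_Urysohn_def metric_space_over_def)
  have MM: "Metric_space M e"
    using M by (simp add: metric_space_over_def)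
  \<comment> \<open>Universality speaks of carriers of natural numbers, so the metric is transported
    along an enumeration of \<open>M\<close>.\<close>
  let ?e = "\<lambda>i j. e (from_nat_into M i) (from_nat_into M j)"
  let ?A = "to_nat_on M ` E"
  have inv: "from_nat_into M (to_nat_on M x) = x" if "x \<in> M" for x
    using M(2) that by simp
  have "Metric_space ?A ?e"
    using MM E(2) inv unfolding Metric_space_def by (auto simp: subset_iff)
  moreover have "\<forall>x\<in>?A. \<forall>y\<in>?A. ?e x y \<in> {0} \<union> S"
    using M(1) E(2) inv by (auto simp: metric_space_over_def subset_iff)
  ultimately obtain F where F: "F \<subseteq> U" "isometric ?A ?e F d"
    using univ[of ?A ?e] E(1) by (auto simp: metric_space_over_def)
  then obtain g where g: "isometry ?A ?e F d g"
    by (auto simp: isometric_def)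
  define l where "l x = g (to_nat_on M x)" for x
  have l: "isometric_on E e U d l"
    using g F(1) E(2) inv by (auto simp: isometric_on_def isometry_def l_def bij_betw_def subset_iff)
  have l': "isometric_on E' e U d l"
    using l E' by (rule isometric_on_subset)
  have ME': "Metric_space E' e"
    using MM Metric_space.subspace E(2) E' by (metis subset_trans)
  have il: "isometry E' e (l ` E') d l" and ih: "isometry E' e (h ` E') d h"
    using isometric_on_imp_isometry[OF ME' MU] l' h by blast+
  let ?\<phi> = "\<lambda>y. h (inv_into E' l y)"
  have invl: "inv_into E' l (l x) = x" if "x \<in> E'" for x
    using il that by (auto simp: isometry_def bij_betw_def)
  have "isometric_on (l ` E') d U d ?\<phi>"
    using h l' invl by (auto simp: isometric_on_def)
  moreover have "Metric_space (l ` E') d"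
    using MU Metric_space.subspace l' by (metis isometric_on_def)
  ultimately have \<phi>: "isometry (l ` E') d (?\<phi> ` l ` E') d ?\<phi>"
    using isometric_on_imp_isometry MU by blast
  have \<phi>h: "?\<phi> ` l ` E' \<subseteq> U"
    using h invl by (auto simp: isometric_on_def)
  have "finite (l ` E')" "l ` E' \<subseteq> U"
    using l' finite_subset[OF E' E(1)] by (auto simp: isometric_on_def)
  with \<phi> \<phi>h have "finite (l ` E') \<and> l ` E' \<subseteq> U \<and> ?\<phi> ` l ` E' \<subseteq> U \<and>
      isometry (l ` E') d (?\<phi> ` l ` E') d ?\<phi>"
    by blast
  then have "\<exists>\<sigma>. isometry U d U d \<sigma> \<and> (\<forall>x\<in>l ` E'. \<sigma> x = ?\<phi> x)"
    by (rule hom[unfolded ultrahomogeneous_def, THEN spec, THEN spec, THEN spec, THEN mp])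
  then obtain \<sigma> where \<sigma>: "isometry U d U d \<sigma>" "\<forall>x\<in>l ` E'. \<sigma> x = ?\<phi> x"
    by blast
  have "isometric_on U d U d \<sigma>"
    using \<sigma>(1) by (auto simp: isometric_on_def isometry_def bij_betw_def)
  then have "isometric_on E e U d (\<lambda>x. \<sigma> (l x))"
    using isometric_on_comp[OF l] by blast
  moreover have "\<forall>x\<in>E'. \<sigma> (l x) = h x"
    using \<sigma>(2) invl by simp
  ultimately show ?thesis
    by (intro exI[of _ "\<lambda>x. \<sigma> (l x)"]) blast
qed

lemma Urysohn_universal:
  assumes U: "countable_Urysohn S U d" and M: "metric_space_over S M e" "countable M"
  shows "\<exists>h. isometric_on M e U d h"
proof -
  define E where "E n = {x \<in> M. to_nat_on M x < n}" for n
  have E: "finite (E n)" "E n \<subseteq> M" "E n \<subseteq> E (Suc n)" for n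
  proof -
    have "inj_on (to_nat_on M) (E n)"
      using inj_on_to_nat_on[OF M(2)] by (rule inj_on_subset) (auto simp: E_def)
    moreover have "to_nat_on M ` E n \<subseteq> {..<n}"
      by (auto simp: E_def)
    ultimately show "finite (E n)"
      using finite_imageD finite_subset by blast
  qed (auto simp: E_def)
  let ?P = "\<lambda>n h. isometric_on (E n) e U d h" and ?Q = "\<lambda>n h h'. \<forall>x\<in>E n. h' x = h x"
  have "\<exists>f. \<forall>n. ?P n (f n) \<and> ?Q n (f n) (f (Suc n))"
  proof (rule dependent_nat_choice)
    show "\<exists>h. ?P 0 h"
      by (simp add: E_def isometric_on_def)
    show "\<exists>h'. ?P (Suc n) h' \<and> ?Q n h h'" if "?P n h" for n h
      using Urysohn_extension[OF U M E(1) E(2) E(3) that] .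
  qed
  then obtain f where f: "\<And>n. ?P n (f n)" "\<And>n. ?Q n (f n) (f (Suc n))"
    by blast
  define h where "h x = f (Suc (to_nat_on M x)) x" for x
  have h: "f n x = h x" if "x \<in> E n" for n x
  proof -
    have "Suc (to_nat_on M x) \<le> n"
      using that by (simp add: E_def)
    then show ?thesis
    proof (induction n rule: dec_induct)
      case (step n)
      then have "x \<in> E n"
        using that by (simp add: E_def)
      then show ?case
        using f(2)[of n] step by simp
    qed (simp add: h_def)
  qed
  have "isometric_on M e U d h"
    unfolding isometric_on_def
  proof (intro conjI ballI)
    show "h ` M \<subseteq> U"
      using f(1) by (auto simp: h_def isometric_on_def E_def)
    fix x y assume xy: "x \<in> M" "y \<in> M"
    obtain n where "to_nat_on M x < n" "to_nat_on M y < n"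
      by (meson less_Suc_eq_le max.cobounded1 max.cobounded2)
    then have "x \<in> E n" "y \<in> E n"
      using xy by (auto simp: E_def)
    then show "d (h x) (h y) = e x y"
      using f(1)[of n] h by (simp add: isometric_on_def)
  qed
  then show ?thesis
    by blast
qed

section \<open>Coding the Urysohn space by words\<close>

lemma emb_length:
  assumes "emb b \<Phi>" "length u = length v"
  shows "length (\<Phi> u) = length (\<Phi> v)"
proof -
  have "length (\<Phi> w) = length (\<Phi> [b..<b + length w])" for w
  proof -
    \<comment> \<open>Every word is the image of the generic word of its length under a letter map
      fixing the constants, and such maps preserve length.\<close>
    define \<sigma> where "\<sigma> x = (if x < b then x else w ! (x - b))" for x
    have "w = map \<sigma> [b..<b + length w]"
      by (rule nth_equalityI) (auto simp: \<sigma>_def)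
    moreover have "\<Phi> (map \<sigma> [b..<b + length w]) = map \<sigma> (\<Phi> [b..<b + length w])"
      by (rule emb_map[OF assms(1)]) (simp add: \<sigma>_def)
    ultimately show ?thesis
      by (metis length_map)
  qed
  with assms(2) show ?thesis
    by metis
qed

text \<open>Image lengths depend only on lengths, so \<open>u\<close> may be replaced by the prefix
  of \<open>v\<close> of equal length, to which \<open>emb_snoc\<close> applies.\<close>

lemma emb_passing:
  assumes "emb b \<Phi>" "length u < length v"
  shows "length (\<Phi> u) < length (\<Phi> v)" "\<Phi> v ! length (\<Phi> u) = v ! length u"
proof -
  let ?n = "length u"
  obtain r where "\<Phi> (take ?n v @ v ! ?n # drop (Suc ?n) v) = \<Phi> (take ?n v) @ v ! ?n # r"
    using emb_snoc[OF assms(1)] by blast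
  moreover have "length (\<Phi> (take ?n v)) = length (\<Phi> u)"
    using assms by (intro emb_length[OF assms(1)]) auto
  ultimately show "length (\<Phi> u) < length (\<Phi> v)" "\<Phi> v ! length (\<Phi> u) = v ! length u"
    using assms(2) by (auto simp: id_take_nth_drop[symmetric] nth_append)
qed

lemma emb_inject:
  assumes "emb b \<Phi>"
  shows "\<Phi> u = \<Phi> v \<longleftrightarrow> u = v"
proof
  assume eq: "\<Phi> u = \<Phi> v"
  then have len: "length u = length v"
    using emb_passing(1)[OF assms] by (metis less_irrefl nat_neq_iff)
  show "u = v"
  proof (rule ccontr)
    assume "u \<noteq> v"
    then obtain w x u' y v' where "x \<noteq> y" "u = w @ [x] @ u'" "v = w @ [y] @ v'"
      using same_length_different[OF _ len] by blast
    then have "length w < length u" "length w < length v" "u ! length w \<noteq> v ! length w"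
      by auto
    then show False
      using emb_passing(2)[OF assms] eq by metis
  qed
qed simp

locale split_spectrum =
  fixes S B D :: "real set" and b :: nat and col :: "nat \<Rightarrow> real"
  assumes S: "S = B \<union> D" and pos: "\<And>s. s \<in> S \<Longrightarrow> 0 < s" and finite_D: "finite D"
    and col: "range col = B" "col ` {..<b} = B" and b: "0 < b"
    and B_triangle: "\<And>x y z. x \<in> B \<Longrightarrow> y \<in> B \<Longrightarrow> z \<in> B \<Longrightarrow> x \<le> y + z"
    and B_D: "\<And>x s. x \<in> B \<Longrightarrow> s \<in> D \<Longrightarrow> 2 * x < s"
    and D_D: "\<And>s t. s \<in> D \<Longrightarrow> t \<in> D \<Longrightarrow> s < t \<Longrightarrow> 2 * s < t"
begin

definition points :: "(real \<Rightarrow> nat list) set" where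
  "points = insert 0 D \<rightarrow>\<^sub>E lists {..<b}"

text \<open>The coordinate at \<open>s \<in> D\<close> names the class modulo distances below \<open>s\<close>; the coordinate at \<open>0\<close>
  codes the edge-coloured graph inside a class of the finest of these equivalences by means of
  passing numbers.\<close>

definition pdist :: "(real \<Rightarrow> nat list) \<Rightarrow> (real \<Rightarrow> nat list) \<Rightarrow> real" where
  "pdist P Q =
     (if \<exists>s\<in>D. P s \<noteq> Q s then Max {s \<in> D. P s \<noteq> Q s}
      else if P 0 = Q 0 then 0
      else if length (P 0) < length (Q 0) then col (Q 0 ! length (P 0))
      else if length (Q 0) < length (P 0) then col (P 0 ! length (Q 0))
      else col 0)"

lemma col_in_B: "col i \<in> B"
  using col by auto

lemma pdist_in_D:
  assumes "s \<in> D" "P s \<noteq> Q s"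
  shows "pdist P Q \<in> D" "s \<le> pdist P Q" "P (pdist P Q) \<noteq> Q (pdist P Q)"
proof -
  have fin: "finite {s \<in> D. P s \<noteq> Q s}"
    using finite_D by simp
  have eq: "pdist P Q = Max {s \<in> D. P s \<noteq> Q s}"
    using assms by (auto simp: pdist_def)
  then show "s \<le> pdist P Q"
    using assms fin by auto
  have "pdist P Q \<in> {s \<in> D. P s \<noteq> Q s}"
    unfolding eq using assms fin by (intro Max_in) auto
  then show "pdist P Q \<in> D" "P (pdist P Q) \<noteq> Q (pdist P Q)"
    by auto
qed

lemma pdist_in_B:
  assumes "\<And>s. s \<in> D \<Longrightarrow> P s = Q s" "P 0 \<noteq> Q 0"
  shows "pdist P Q \<in> B"
  using assms col_in_B by (simp add: pdist_def)

lemma pdist_0: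
  assumes "\<And>s. s \<in> D \<Longrightarrow> P s = Q s" "P 0 = Q 0"
  shows "pdist P Q = 0"
  using assms by (simp add: pdist_def)

lemma pdist_cases:
  obtains s where "s \<in> D" "P s \<noteq> Q s" "pdist P Q \<in> D" |
    "\<And>s. s \<in> D \<Longrightarrow> P s = Q s" "P 0 \<noteq> Q 0" "pdist P Q \<in> B" |
    "\<And>s. s \<in> D \<Longrightarrow> P s = Q s" "P 0 = Q 0" "pdist P Q = 0"
proof (cases "\<exists>s\<in>D. P s \<noteq> Q s")
  case True
  then show ?thesis
    using that(1) pdist_in_D(1) by blast
next
  case False
  then have eq: "\<And>s. s \<in> D \<Longrightarrow> P s = Q s"
    by blast
  then show ?thesis
    using that(2,3) pdist_in_B pdist_0 by (cases "P 0 = Q 0") simp_all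
qed

lemma pdist_nonneg: "0 \<le> pdist P Q"
  using pos S by (cases P Q rule: pdist_cases) (auto simp: less_imp_le)

lemma points_eqI:
  assumes "P \<in> points" "Q \<in> points" "\<And>s. s \<in> D \<Longrightarrow> P s = Q s" "P 0 = Q 0"
  shows "P = Q"
  using assms(1,2)[unfolded points_def] by (rule PiE_ext) (use assms(3,4) in auto)

text \<open>The largest coordinate in \<open>D\<close> separating \<open>P\<close> from
  \<open>R\<close> separates \<open>Q\<close> from one of them. Within one class, a \<open>Q\<close>
  outside it is more than far enough; a \<open>Q\<close> inside it leaves only distances in
  \<open>B\<close> or zero.\<close>

lemma pdist_triangle: "pdist P R \<le> pdist P Q + pdist Q R"
proof (cases P R rule: pdist_cases)
  case (1 s)
  define t where "t = pdist P R"
  have t: "t \<in> D" "P t \<noteq> R t"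
    using pdist_in_D[of s P R] 1 by (auto simp: t_def)
  then have "P t \<noteq> Q t \<or> Q t \<noteq> R t"
    by auto
  then have "t \<le> pdist P Q \<or> t \<le> pdist Q R"
    using pdist_in_D(2)[of t P Q] pdist_in_D(2)[of t Q R] t by blast
  then show ?thesis
    using pdist_nonneg[of P Q] pdist_nonneg[of Q R] by (auto simp: t_def)
next
  case 2
  show ?thesis
  proof (cases "\<exists>s\<in>D. P s \<noteq> Q s")
    case True
    then have "pdist P Q \<in> D"
      using pdist_in_D(1)[of _ P Q] by blast
    then have "2 * pdist P R < pdist P Q"
      using B_D 2 by blast
    then show ?thesis
      using pdist_nonneg[of Q R] pdist_nonneg[of P R] by linarith
  next
    case False
    then have QR: "\<And>s. s \<in> D \<Longrightarrow> Q s = R s"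
      using 2 by auto
    have "P 0 = Q 0 \<Longrightarrow> pdist P R = pdist Q R"
      using False QR 2 by (simp add: pdist_def)
    moreover have "Q 0 = R 0 \<Longrightarrow> pdist P R = pdist P Q"
      using False QR 2 by (simp add: pdist_def)
    moreover have "pdist P Q \<in> B" if "P 0 \<noteq> Q 0"
      using False that pdist_in_B[of P Q] by blast
    moreover have "pdist Q R \<in> B" if "Q 0 \<noteq> R 0"
      using QR that pdist_in_B[of Q R] by blast
    ultimately show ?thesis
      using B_triangle 2(3) pdist_nonneg[of P Q] pdist_nonneg[of Q R] by fastforce
  qed
next
  case 3
  then show ?thesis
    using pdist_nonneg[of P Q] pdist_nonneg[of Q R] by simp
qed

lemma metric_points: "metric_space_over S points pdist"
  unfolding metric_space_over_def
proof (intro conjI ballI)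
  show "Metric_space points pdist"
  proof
    show "pdist P Q = pdist Q P" for P Q
    proof -
      have "{s \<in> D. P s \<noteq> Q s} = {s \<in> D. Q s \<noteq> P s}"
        by auto
      then show ?thesis
        by (auto simp: pdist_def)
    qed
    show "pdist P Q = 0 \<longleftrightarrow> P = Q" if "P \<in> points" "Q \<in> points" for P Q
    proof
      assume "pdist P Q = 0"
      then show "P = Q"
        using that pos S by (cases P Q rule: pdist_cases) (auto intro: points_eqI)
    qed (auto simp: pdist_def)
  qed (auto simp: pdist_nonneg pdist_triangle)
  show "pdist P Q \<in> {0} \<union> S" for P Q
    using S by (cases P Q rule: pdist_cases) auto
qed

lemma countable_points: "countable points"
  unfolding points_def using finite_D by (intro countable_PiE) auto

definition act :: "(nat list \<Rightarrow> nat list) \<Rightarrow> (real \<Rightarrow> nat list) \<Rightarrow> real \<Rightarrow> nat list" where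
  "act \<Phi> P = (\<lambda>s\<in>insert 0 D. \<Phi> (P s))"

lemma isometric_on_act:
  assumes \<Phi>: "emb b \<Phi>"
  shows "isometric_on points pdist points pdist (act \<Phi>)"
  unfolding isometric_on_def
proof (intro conjI ballI)
  show "act \<Phi> ` points \<subseteq> points"
    unfolding act_def points_def
    using emb_lists[OF \<Phi> order_refl] PiE_mem[of _ "insert 0 D" "\<lambda>_. lists {..<b}"]
    by (intro image_subsetI) (simp only: restrict_PiE_iff, blast)
  fix P Q assume "P \<in> points" "Q \<in> points"
  have D: "act \<Phi> P s = act \<Phi> Q s \<longleftrightarrow> P s = Q s" if "s \<in> D" for s
    using that emb_inject[OF \<Phi>] by (simp add: act_def)
  then have "{s \<in> D. act \<Phi> P s \<noteq> act \<Phi> Q s} = {s \<in> D. P s \<noteq> Q s}"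
    by auto
  moreover have "length (\<Phi> u) < length (\<Phi> v) \<longleftrightarrow> length u < length v" for u v
    using emb_passing(1)[OF \<Phi>] emb_length[OF \<Phi>] by (metis linorder_neqE_nat order_less_asym order_less_irrefl)
  moreover have "act \<Phi> P 0 = \<Phi> (P 0)" "act \<Phi> Q 0 = \<Phi> (Q 0)"
    by (simp_all add: act_def)
  ultimately show "pdist (act \<Phi> P) (act \<Phi> Q) = pdist P Q"
    unfolding pdist_def using D emb_inject[OF \<Phi>] emb_passing(2)[OF \<Phi>] by (simp cong: bex_cong)
qed

lemma ex_coding:
  assumes U: "countable U" and d: "metric_space_over S U d"
  shows "\<exists>f. isometric_on U d points pdist f"
proof -
  interpret Metric_space U d
    using d by (simp add: metric_space_over_def)
  have dS: "d x y \<in> {0} \<union> S" if "x \<in> U" "y \<in> U" for x y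
    using d that by (auto simp: metric_space_over_def)
  have small: "2 * d x y < s" if "x \<in> U" "y \<in> U" "s \<in> D" "d x y < s" for x y s
    using dS[OF that(1,2)] that B_D D_D S by auto
  let ?idx = "to_nat_on U"
  have idx: "?idx x = ?idx y \<longleftrightarrow> x = y" if "x \<in> U" "y \<in> U" for x y
    using U that by simp
  \<comment> \<open>A class modulo distances below \<open>s\<close> is named by the least index of
    its members.\<close>
  define rep where "rep s x = (LEAST n. \<exists>y\<in>U. n = ?idx y \<and> d x y < s)" for s x
  have rep: "rep s x = rep s y \<longleftrightarrow> d x y < s" if x: "x \<in> U" and y: "y \<in> U" and s: "s \<in> D" for s x y
  proof
    have ex: "\<exists>y\<in>U. rep s x = ?idx y \<and> d x y < s" if "x \<in> U" for x
      unfolding rep_def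
      by (rule LeastI[of "\<lambda>n. \<exists>y\<in>U. n = ?idx y \<and> d x y < s" "?idx x"]) (use that s pos S in auto)
    assume "rep s x = rep s y"
    then obtain z where z: "z \<in> U" "d x z < s" "d y z < s"
      using ex[OF x] ex[OF y] idx by metis
    then have "2 * d x z < s" "2 * d y z < s"
      using small s x y by auto
    then show "d x y < s"
      using triangle[OF x z(1) y] commute[of y z] by linarith
  next
    assume xy: "d x y < s"
    have "d x z < s \<longleftrightarrow> d y z < s" if z: "z \<in> U" for z
    proof
      assume "d x z < s"
      then have "2 * d x z < s" "2 * d x y < s"
        using small s x y z xy by auto
      then show "d y z < s"
        using triangle[OF y x z] commute[of x y] by linarith
    next
      assume "d y z < s"
      then have "2 * d y z < s" "2 * d x y < s"
        using small s x y z xy by auto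
      then show "d x z < s"
        using triangle[OF x y z] by linarith
    qed
    then show "rep s x = rep s y"
      unfolding rep_def by (metis (no_types, lifting))
  qed
  \<comment> \<open>The default letter 0 stands for distances outside \<open>B\<close>; these are
    settled by the coordinates in \<open>D\<close> or by equality, so it is never decoded.\<close>
  define code where "code r = (if r \<in> B then SOME i. i < b \<and> col i = r else 0)" for r
  have code: "code r < b" "r \<in> B \<Longrightarrow> col (code r) = r" for r
  proof -
    have "code r < b \<and> (r \<in> B \<longrightarrow> col (code r) = r)"
    proof (cases "r \<in> B")
      case True
      then have "\<exists>i. i < b \<and> col i = r"
        using col(2) by auto
      from someI_ex[OF this] show ?thesis
        using True by (simp add: code_def)
    qed (simp add: code_def b)
    then show "code r < b" "r \<in> B \<Longrightarrow> col (code r) = r"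
      by auto
  qed
  \<comment> \<open>At \<open>0\<close>, the word of \<open>x\<close> lists the coded distances to
    the points enumerated before \<open>x\<close>, so passing letters return distances. At
    \<open>s \<in> D\<close> only equality matters, so a number is stored as a length.\<close>
  define f where "f x = (\<lambda>s\<in>insert 0 D. if s = 0
    then map (\<lambda>i. code (d x (from_nat_into U i))) [0..<?idx x] else replicate (rep s x) 0)" for x
  have D0: "0 \<notin> D"
    using pos S by auto
  have f_D: "f x s = replicate (rep s x) 0" if "s \<in> D" for s x
    using that D0 by (auto simp: f_def)
  have f_0: "f x 0 = map (\<lambda>i. code (d x (from_nat_into U i))) [0..<?idx x]" for x
    by (simp add: f_def)
  have f_D_eq: "f x s = f y s \<longleftrightarrow> d x y < s" if "x \<in> U" "y \<in> U" "s \<in> D" for x y s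
    using rep[OF that] f_D[OF that(3)] by (simp add: replicate_eq_replicate)
  have passing: "col (f y 0 ! length (f x 0)) = d x y"
    if "x \<in> U" "y \<in> U" "?idx x < ?idx y" "d x y \<in> B" for x y
    using that U code(2) commute[of x y] by (simp add: f_0)
  have "isometric_on U d points pdist f"
    unfolding isometric_on_def
  proof (intro conjI ballI)
    have "replicate n 0 \<in> lists {..<b}" for n
      using b by (induction n) auto
    moreover have "map (\<lambda>i. code (F i)) xs \<in> lists {..<b}" for F and xs :: "nat list"
      using code(1) by (induction xs) auto
    ultimately show "f ` U \<subseteq> points"
      unfolding f_def points_def by (intro image_subsetI) (simp only: restrict_PiE_iff split: if_split, blast)
    fix x y assume x: "x \<in> U" and y: "y \<in> U"
    consider "x = y" | "x \<noteq> y" "d x y \<in> B" | "d x y \<in> D"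
      using dS[OF x y] S x y by auto
    then show "pdist (f x) (f y) = d x y"
    proof cases
      case 1
      then show ?thesis
        using x by (simp add: pdist_def)
    next
      case 2
      have "d x y < s" if "s \<in> D" for s
        using B_D[OF 2(2) that] nonneg[of x y] by linarith
      then have "\<not> (\<exists>s\<in>D. f x s \<noteq> f y s)"
        using f_D_eq x y by blast
      moreover have "length (f x 0) = ?idx x" "length (f y 0) = ?idx y"
        by (simp_all add: f_0)
      moreover have "?idx x \<noteq> ?idx y"
        using idx x y 2 by blast
      ultimately show ?thesis
        unfolding pdist_def using passing[OF x y] passing[OF y x] 2 commute[of x y] by auto
    next
      case 3
      then have "{s \<in> D. f x s \<noteq> f y s} = {s \<in> D. s \<le> d x y}"
        using f_D_eq x y by (auto simp: not_less)
      moreover have "Max {s \<in> D. s \<le> d x y} = d x y"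
        using 3 finite_D by (intro Max_eqI) auto
      ultimately show ?thesis
        unfolding pdist_def using 3 f_D_eq[OF x y 3] by auto
    qed
  qed
  then show ?thesis
    by blast
qed

theorem big_Ramsey:
  assumes U: "countable_Urysohn S U d"
  shows "admits_finite_big_Ramsey_degrees U d"
  unfolding admits_finite_big_Ramsey_degrees_def
proof (intro allI impI)
  fix A assume A: "A \<subseteq> U" "finite A"
  have cU: "countable U" and mU: "metric_space_over S U d" and MU: "Metric_space U d"
    using U by (auto simp: countable_Urysohn_def metric_space_over_def)
  obtain f where f: "isometric_on U d points pdist f"
    using ex_coding[OF cU mU] by blast
  obtain h where h: "isometric_on points pdist U d h"
    using Urysohn_universal[OF U metric_points countable_points] by blast
  define r where "r = card A"
  define J where "J = {..<r} \<times> insert 0 D"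
  have "finite J"
    using finite_D by (simp add: J_def)
  then obtain t where t: "\<And>C::(nat \<times> real \<Rightarrow> nat list) \<Rightarrow> nat. finite (range C) \<Longrightarrow>
    \<exists>\<Phi>. emb b \<Phi> \<and> card ((\<lambda>us. C (\<lambda>j\<in>J. \<Phi> (us j))) ` (J \<rightarrow> lists {..<b})) \<le> t"
    using finite_colours_of_families by blast
  define decode where "decode us = (\<lambda>i. \<lambda>s\<in>insert 0 D. us (i, s)) ` {..<r}"
    for us :: "nat \<times> real \<Rightarrow> nat list"
  have "\<exists>X\<subseteq>U. isometric U d X d \<and> card (c ` copies X d A d) \<le> t"
    if c: "c \<in> copies U d A d \<rightarrow> {..<k}" for k :: nat and c
  proof -
    \<comment> \<open>Families that do not decode to copies of \<open>A\<close> get the dummy colour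
      0.\<close>
    define C where "C us = (if h ` decode us \<in> copies U d A d then c (h ` decode us) else 0)" for us
    have "range C \<subseteq> insert 0 {..<k}"
      using c by (auto simp: C_def)
    then have finC: "finite (range C)"
      by (rule finite_subset) simp
    then obtain \<Phi> where \<Phi>: "emb b \<Phi>"
      "card ((\<lambda>us. C (\<lambda>j\<in>J. \<Phi> (us j))) ` (J \<rightarrow> lists {..<b})) \<le> t"
      using t by blast
    define g where "g x = h (act \<Phi> (f x))" for x
    have g: "isometric_on U d U d g"
      unfolding g_def
      by (rule isometric_on_comp[OF isometric_on_comp[OF f isometric_on_act[OF \<Phi>(1)]] h])
    then have iso: "isometry U d (g ` U) d g"
      by (rule isometric_on_imp_isometry[OF MU MU])
    have "c Y \<in> (\<lambda>us. C (\<lambda>j\<in>J. \<Phi> (us j))) ` (J \<rightarrow> lists {..<b})"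
      if "Y \<in> copies (g ` U) d A d" for Y
    proof -
      have Y: "Y \<subseteq> g ` U" "isometric A d Y d"
        using \<open>Y \<in> _\<close> by (auto simp: copies_def)
      then have YU: "Y \<in> copies U d A d"
        using g by (auto simp: copies_def isometric_on_def)
      obtain Z where Z: "Z \<subseteq> U" "Y = g ` Z"
        using Y(1) by (auto simp: subset_image_iff)
      have "card Y = r" "finite Y"
        using Y(2) A(2) by (auto simp: isometric_def isometry_def r_def bij_betw_same_card bij_betw_finite)
      moreover have "inj_on g Z"
        using iso Z(1) by (auto simp: isometry_def bij_betw_def intro: inj_on_subset)
      ultimately have "card Z = r" "finite Z"
        using Z(2) by (auto simp: card_image finite_image_iff)
      \<comment> \<open>Any enumeration of \<open>Z\<close> serves, since each copy needs only one
        family that codes it.\<close>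
      then obtain z where z: "bij_betw z {..<r} Z"
        using ex_bij_betw_nat_finite[of Z] by (auto simp: atLeast0LessThan)
      define us where "us = (\<lambda>(i, s). f (z i) s)"
      have "f (z i) \<in> points" if "i < r" for i
        using that z Z(1) f by (auto simp: bij_betw_def isometric_on_def)
      then have us: "us \<in> J \<rightarrow> lists {..<b}"
        by (auto simp: us_def J_def points_def PiE_iff simp del: in_lists_conv_set)
      have "decode (\<lambda>j\<in>J. \<Phi> (us j)) = (\<lambda>i. act \<Phi> (f (z i))) ` {..<r}"
        unfolding decode_def by (rule image_cong) (auto simp: J_def us_def act_def)
      also have "\<dots> = (\<lambda>x. act \<Phi> (f x)) ` Z"
        using z by (auto simp: bij_betw_def)
      finally have "h ` decode (\<lambda>j\<in>J. \<Phi> (us j)) = Y"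
        by (simp add: Z(2) g_def image_image)
      then have "C (\<lambda>j\<in>J. \<Phi> (us j)) = c Y"
        using YU by (simp add: C_def)
      with us show ?thesis
        by (intro image_eqI[where x = us]) simp_all
    qed
    then have "c ` copies (g ` U) d A d \<subseteq> (\<lambda>us. C (\<lambda>j\<in>J. \<Phi> (us j))) ` (J \<rightarrow> lists {..<b})"
      by blast
    moreover have "finite ((\<lambda>us. C (\<lambda>j\<in>J. \<Phi> (us j))) ` (J \<rightarrow> lists {..<b}))"
      using finC by (rule finite_subset[rotated]) auto
    ultimately have "card (c ` copies (g ` U) d A d)
        \<le> card ((\<lambda>us. C (\<lambda>j\<in>J. \<Phi> (us j))) ` (J \<rightarrow> lists {..<b}))"
      by (rule card_mono[rotated])
    then have "card (c ` copies (g ` U) d A d) \<le> t"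
      using \<Phi>(2) by (rule order_trans)
    moreover have "g ` U \<subseteq> U" "isometric U d (g ` U) d"
      using g iso by (auto simp: isometric_on_def isometric_def)
    ultimately show ?thesis
      by blast
  qed
  then show "finite_big_Ramsey_degree A d U d"
    unfolding finite_big_Ramsey_degree_def by blast
qed

end

section \<open>The blocks of a simple spectrum\<close>

lemma split_spectrum_blocks:
  assumes "simple_spectrum S" "S \<noteq> {}"
    and card: "\<And>i. 1 < i \<Longrightarrow> i \<le> num_blocks S \<Longrightarrow> card (block S i) = 1"
  shows "\<exists>B D b col. split_spectrum S B D b col"
proof -
  have spec: "spectrum S" and indep: "\<And>i j. 1 \<le> i \<Longrightarrow> i < j \<Longrightarrow> j \<le> num_blocks S \<Longrightarrow>
      independent_blocks (block S i) (block S j)"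
    using assms(1) by (auto simp: simple_spectrum_def)
  have fin: "finite S" and pos: "\<And>s. s \<in> S \<Longrightarrow> 0 < s"
    using spec by (auto simp: spectrum_def)
  define B where "B = block S 1"
  define D where "D = (\<Union>i\<in>{2..num_blocks S}. block S i)"
  have finb: "finite (block S i)" for i
    using block_subset fin by (rule finite_subset)
  have lt: "2 * x < y" if "x \<in> block S i" "y \<in> block S j" "1 \<le> i" "i < j" "j \<le> num_blocks S" for x y i j
  proof -
    have "x \<le> Max (block S i)" "Min (block S j) \<le> y"
      using that finb by auto
    then show ?thesis
      using indep[OF that(3-5)] by (simp add: independent_blocks_def)
  qed
  have n: "1 \<le> num_blocks S"
    using Union_blocks[OF spec] \<open>S \<noteq> {}\<close> by (cases "num_blocks S") auto
  have "{1..num_blocks S} = insert 1 {2..num_blocks S}"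
    using n by auto
  then have SBD: "S = B \<union> D"
    using Union_blocks[OF spec] by (simp add: B_def D_def)
  have Bne: "B \<noteq> {}"
    unfolding B_def by (rule block_nonempty[OF spec order_refl n])
  have B: "B = {a \<in> S. a \<le> 2 * Min S}"
    unfolding B_def by (subst block.simps) (simp add: first_block_def)
  obtain code where code: "bij_betw code {..<card B} B"
    using ex_bij_betw_nat_finite[of B] finb[of 1] by (auto simp: B_def atLeast0LessThan)
  have cardB: "0 < card B"
    using Bne finb[of 1] by (simp add: B_def card_gt_0_iff)
  \<comment> \<open>Repeating \<open>code 0\<close> makes \<open>col\<close> total without leaving
    \<open>B\<close>.\<close>
  define col where "col i = code (if i < card B then i else 0)" for i
  have code_img: "code ` {..<card B} = B"
    using code by (simp add: bij_betw_def)
  have "col ` {..<card B} = code ` {..<card B}"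
    by (rule image_cong) (auto simp: col_def)
  with code_img have col1: "col ` {..<card B} = B"
    by simp
  moreover have "col i \<in> B" for i
    using code_img cardB by (auto simp: col_def)
  ultimately have col2: "range col = B"
    by blast
  have "split_spectrum S B D (card B) col"
  proof
    show "finite D"
      using fin SBD by simp
    \<comment> \<open>The first block lies between \<open>Min S\<close> and
      \<open>2 * Min S\<close>.\<close>
    show "x \<le> y + z" if "x \<in> B" "y \<in> B" "z \<in> B" for x y z
    proof -
      have "x \<le> 2 * Min S" "Min S \<le> y" "Min S \<le> z"
        using that fin by (auto simp: B)
      then show ?thesis
        by linarith
    qed
    show "2 * x < s" if "x \<in> B" "s \<in> D" for x s
      using that lt[of x 1 s] by (force simp: B_def D_def)
    show "2 * s < t" if st: "s \<in> D" "t \<in> D" "s < t" for s t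
    proof -
      obtain i j where i: "s \<in> block S i" "i \<in> {2..num_blocks S}"
        and j: "t \<in> block S j" "j \<in> {2..num_blocks S}"
        using st by (auto simp: D_def)
      have "0 < s" "0 < t"
        using st SBD pos by auto
      consider "i < j" | "i = j" | "j < i"
        by linarith
      then show ?thesis
      proof cases
        case 1
        then show ?thesis
          using lt[OF i(1) j(1)] i j by simp
      next
        case 2
        then have "s = t"
          using card[of i] i j by (auto simp: card_1_singleton_iff)
        then show ?thesis
          using st by simp
      next
        case 3
        then have "2 * t < s"
          using lt[OF j(1) i(1)] i j by simp
        then show ?thesis
          using st \<open>0 < t\<close> by simp
      qed
    qed
  qed (use SBD pos col1 col2 cardB in auto)
  then show ?thesis
    by blast
qed

theorem theorem3p36:
  fixes S :: "real set" and k :: nat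
    and U :: "'a set" and d :: "'a \<Rightarrow> 'a \<Rightarrow> real"
  assumes "simple_spectrum S"
    and "k = num_blocks S"
    and "card (block S 1) + 1 = k"
    and "\<And>i. 1 < i \<Longrightarrow> i \<le> k \<Longrightarrow> card (block S i) = 1"
    and "countable_Urysohn S U d"
  shows "admits_finite_big_Ramsey_degrees U d"
proof -
  \<comment> \<open>The cardinality equation gives \<open>1 \<le> k\<close>, so there is a first
    block.\<close>
  have "block S 1 \<noteq> {}"
    using assms(1,2,3) block_nonempty[of S 1] by (auto simp: simple_spectrum_def)
  then have "S \<noteq> {}"
    using block_subset[of S 1] by blast
  then obtain B D b col where "split_spectrum S B D b col"
    using split_spectrum_blocks[OF assms(1)] assms(2,4) by metis
  then show ?thesis
    using split_spectrum.big_Ramsey assms(5) by blast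
qed

end
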